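(* Let an ontic representation with ontic set $\Lambda$ be given, with valuation $1$-forms $\xi_{\lambda'}$ on $\mathcal{M}_{\mathcal{E}}$ (effects), $\Gamma_{\lambda'\lambda}$ on $\mathcal{M}_{\mathcal{T}}$ (transformations) and $\mu_{\lambda}$ on $\mathcal{M}_{\mathcal{P}}$ (states), where $\lambda,\lambda'\in\Lambda$. Assume the representation is flat, i.e. each of $\mathcal{M}_{\mathcal{E}},\mathcal{M}_{\mathcal{T}},\mathcal{M}_{\mathcal{P}}$ is the whole ambient real vector space with no topological failure, so that every loop in it is a boundary. Then: (1) the representation is noncontextual for measurements if and only if the contextual curvature $F_{\lambda'}=d\xi_{\lambda'}$ is zero for all $\lambda'\in\Lambda$; (2) the representation is noncontextual for transformations if and only if $F_{\lambda'\lambda}=d\Gamma_{\lambda'\lambda}$ is zero for all $\lambda,\lambda'\in\Lambda$; (3) the representation is noncontextual for states if and only if $F_{\lambda}=d\mu_{\lambda}$ is zero for all $\lambda\in\Lambda$.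
   Context: Generalized probability theory and ontic representation. A generalized probability theory has sets of states $\mathcal{P}$, transformations $\mathcal{T}$ and effects $\mathcal{E}$, each a convex subset of a finite-dimensional real vector space, and probabilities $p(E|T,P)\in[0,1]$. An ontic representation consists of a set $\Lambda$ of ontic (hidden) variables and valuation functions $\xi,\Gamma,\mu$, with values in $[0,1]$ on $\mathcal{E},\mathcal{T},\mathcal{P}$ respectively, such that $p(E|T,P)=\sum_{\lambda,\lambda'}\xi(E|\lambda')\,\Gamma(\lambda',T,\lambda)\,\mu(\lambda|P)$. Geometric encoding. For each $X\in\{\mathcal{E},\mathcal{T},\mathcal{P}\}$ there is a space $\mathcal{M}_X$, which is either a piecewise linear manifold given as an oriented simplicial complex (discrete case) or a smooth manifold (continuous case). $\mathcal{C}_n(\mathcal{M}_X)$ denotes its $n$-chains with real coefficients (simplicial chains, respectively smooth singular chains) with boundary operator $\partial$, and $\mathcal{C}^n(\mathcal{M}_X)$ denotes its $n$-forms (linear functionals on $\mathcal{C}_n$, respectively smooth differential $n$-forms) with coboundary operator $d$ (the exterior derivative in the smooth case). The pairing is $\langle\omega|S\rangle=\int_S\omega\in\mathbb{R}$ for an $n$-form $\omega$ and an $n$-chain $S$, and it satisfies Stokes' theorem $\langle\omega|\partial S\rangle=\langle d\omega|S\rangle$. Objects (effects, transformations, states) are vectors, viewed as oriented $1$-dimensional pieces of $\mathcal{M}_X$, i.e. as $1$-chains $|E\rangle,|T\rangle,|P\rangle$. The valuation functions are $1$-forms: $\xi(E|\lambda')=\langle\xi_{\lambda'}|E\rangle$,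 $\Gamma(\lambda',T,\lambda)=\langle\Gamma_{\lambda'\lambda}|T\rangle$, $\mu(\lambda|P)=\langle\mu_{\lambda}|P\rangle$. Loops and noncontextuality. A loop is a $1$-chain $\gamma$ with $\partial\gamma=0$. Operational equivalences (linear relations such as $\sum_r b_rE_r=0$ among objects) are identified with loops ($\gamma=\sum_r b_r|E_r\rangle$), and every loop is regarded as an operational equivalence. The phase of a valuation $1$-form along $\gamma$ is its pairing with $\gamma$. The representation is noncontextual for measurements if $\langle\xi_{\lambda'}|\gamma\rangle=0$ for every loop $\gamma$ in $\mathcal{M}_{\mathcal{E}}$ and every $\lambda'\in\Lambda$; noncontextual for transformations if $\langle\Gamma_{\lambda'\lambda}|\gamma\rangle=0$ for every loop $\gamma$ in $\mathcal{M}_{\mathcal{T}}$ and all $\lambda,\lambda'\in\Lambda$; noncontextual for states if $\langle\mu_\lambda|\gamma\rangle=0$ for every loop $\gamma$ in $\mathcal{M}_{\mathcal{P}}$ and every $\lambda\in\Lambda$. Flatness. Each $\mathcal{M}_X$ is $\mathbb{R}^{n_X}$ (continuous case) or a triangulation of $\mathbb{R}^{n_X}$ (discrete case); in particular every loop $\gamma$ equals $\partial S$ for some $2$-chain $S$. *)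

theory Defs
  imports
    "HOL-Analysis.Analysis"
    "HOL-Library.Poly_Mapping"
    "HOL-Combinatorics.Permutations"
begin

section \<open>Real chains\<close>

text \<open>Finitely supported real functions on a type of cells: formal real linear combinations.\<close>

type_synonym 's real_chain = "'s \<Rightarrow>\<^sub>0 real"

instantiation poly_mapping :: (type, real_vector) real_vector
begin

lift_definition scaleR_poly_mapping :: "real \<Rightarrow> ('a \<Rightarrow>\<^sub>0 'b) \<Rightarrow> ('a \<Rightarrow>\<^sub>0 'b)"
  is "\<lambda>r f x. r *\<^sub>R f x"
  by (erule finite_subset[rotated]) auto

instance
  by standard (transfer; simp add: fun_eq_iff scaleR_add_right scaleR_add_left)+

end

definition linear_extension :: "('s \<Rightarrow> 'b::real_vector) \<Rightarrow> 's real_chain \<Rightarrow> 'b" where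
  "linear_extension f c = (\<Sum>s\<in>Poly_Mapping.keys c. Poly_Mapping.lookup c s *\<^sub>R f s)"


section \<open>Discrete case: oriented simplicial complexes\<close>

text \<open>A geometric simplicial complex, not necessarily finite. Local finiteness makes the subspace
  topology of \<open>\<Union>K\<close> the topology of the complex. As in the library, the face relation includes the
  empty face, which is the simplex of dimension \<open>-1\<close>.\<close>

definition geometric_complex :: "'v::euclidean_space set set \<Rightarrow> bool" where
  "geometric_complex K \<longleftrightarrow>
     (\<forall>S\<in>K. \<exists>n. n simplex S) \<and>
     (\<forall>S\<in>K. \<forall>F. F face_of S \<longrightarrow> F \<in> K) \<and>
     (\<forall>S\<in>K. \<forall>T\<in>K. (S \<inter> T) face_of S) \<and>
     (\<forall>x\<in>\<Union>K. \<exists>U. open U \<and> x \<in> U \<and> finite {S \<in> K. S \<inter> U \<noteq> {}})"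

text \<open>An orientation is given by choosing an ordering of the vertices of each simplex.\<close>

definition orientation_of ::
    "'v::euclidean_space set set \<Rightarrow> ('v set \<Rightarrow> 'v list) \<Rightarrow> bool" where
  "orientation_of K ord \<longleftrightarrow>
     (\<forall>S\<in>K. distinct (ord S) \<and> set (ord S) = {v. v extreme_point_of S})"

definition simplicial_chains :: "nat \<Rightarrow> 'v::euclidean_space set set \<Rightarrow> 'v set real_chain set" where
  "simplicial_chains n K = {c. \<forall>S\<in>Poly_Mapping.keys c. S \<in> K \<and> int n simplex S}"

definition relative_sign :: "'a list \<Rightarrow> 'a list \<Rightarrow> real" where
  "relative_sign xs ys =
     of_int (sign (THE p. p permutes {..<length xs} \<and> permute_list p xs = ys))"

text \<open>The boundary of the oriented simplex \<open>[v\<^sub>0, \<dots>, v\<^sub>n]\<close> is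
  \<open>\<Sum>i. (-1)^i [v\<^sub>0, \<dots>, v\<^sub>i\<^sub>-\<^sub>1, v\<^sub>i\<^sub>+\<^sub>1, \<dots>, v\<^sub>n]\<close>, where an oriented face equals plus or minus the
  basis element with the chosen orientation. Vertices have zero boundary (no augmentation).\<close>

definition simplex_boundary ::
    "('v::euclidean_space set \<Rightarrow> 'v list) \<Rightarrow> 'v set \<Rightarrow> 'v set real_chain" where
  "simplex_boundary ord S =
     (let vs = ord S in
      if length vs \<le> 1 then 0
      else \<Sum>i<length vs.
        let ws = take i vs @ drop (Suc i) vs; F = convex hull (set ws)
        in Poly_Mapping.single F ((-1) ^ i * relative_sign (ord F) ws))"

definition simplicial_boundary ::
    "('v::euclidean_space set \<Rightarrow> 'v list) \<Rightarrow> 'v set real_chain \<Rightarrow> 'v set real_chain" where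
  "simplicial_boundary ord = linear_extension (simplex_boundary ord)"

text \<open>Cochains are linear functionals on chains, and the coboundary is the transpose of the
  boundary.\<close>

definition simplicial_coboundary ::
    "('v::euclidean_space set \<Rightarrow> 'v list) \<Rightarrow> ('v set real_chain \<Rightarrow> real) \<Rightarrow>
     ('v set real_chain \<Rightarrow> real)" where
  "simplicial_coboundary ord \<phi> = (\<lambda>c. \<phi> (simplicial_boundary ord c))"


section \<open>Continuous case: smooth chains and differential forms on open sets\<close>

fun times_differentiable_on ::
    "nat \<Rightarrow> 'a::real_normed_vector set \<Rightarrow> ('a \<Rightarrow> 'b::real_normed_vector) \<Rightarrow> bool" where
  "times_differentiable_on 0 U f \<longleftrightarrow> continuous_on U f"
| "times_differentiable_on (Suc k) U f \<longleftrightarrow>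
     (\<forall>x\<in>U. f differentiable at x) \<and>
     (\<forall>v. times_differentiable_on k U (\<lambda>x. frechet_derivative f (at x) v))"

text \<open>Used for open sets \<open>U\<close> only.\<close>

definition smooth_on ::
    "'a::real_normed_vector set \<Rightarrow> ('a \<Rightarrow> 'b::real_normed_vector) \<Rightarrow> bool" where
  "smooth_on U f \<longleftrightarrow> (\<forall>k. times_differentiable_on k U f)"

text \<open>Smooth singular 1-simplices. The restriction normalises the values outside \<open>{0..1}\<close>, so that
  equal curves are equal basis elements.\<close>

definition smooth_curves :: "'x::euclidean_space set \<Rightarrow> (real \<Rightarrow> 'x) set" where
  "smooth_curves U = {restrict g {0..1} | g. smooth_on UNIV g \<and> g ` {0..1} \<subseteq> U}"

definition singular_1_chains :: "'x::euclidean_space set \<Rightarrow> (real \<Rightarrow> 'x) real_chain set" where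
  "singular_1_chains U = {c. Poly_Mapping.keys c \<subseteq> smooth_curves U}"

definition singular_boundary :: "(real \<Rightarrow> 'x) real_chain \<Rightarrow> 'x real_chain" where
  "singular_boundary =
     linear_extension (\<lambda>\<sigma>. Poly_Mapping.single (\<sigma> 1) 1 - Poly_Mapping.single (\<sigma> 0) 1)"

text \<open>In \<open>\<omega> x v\<close> the first argument is the base point and the second the tangent vector.\<close>

definition smooth_1_form_on :: "'x::euclidean_space set \<Rightarrow> ('x \<Rightarrow> 'x \<Rightarrow> real) \<Rightarrow> bool" where
  "smooth_1_form_on U \<omega> \<longleftrightarrow>
     (\<forall>x\<in>U. linear (\<omega> x)) \<and> (\<forall>v. smooth_on U (\<lambda>x. \<omega> x v))"

definition curve_integral :: "('x::euclidean_space \<Rightarrow> 'x \<Rightarrow> real) \<Rightarrow> (real \<Rightarrow> 'x) \<Rightarrow> real" where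
  "curve_integral \<omega> \<sigma> =
     integral {0..1} (\<lambda>t. \<omega> (\<sigma> t) (vector_derivative \<sigma> (at t within {0..1})))"

definition exterior_derivative ::
    "('x::euclidean_space \<Rightarrow> 'x \<Rightarrow> real) \<Rightarrow> ('x \<Rightarrow> 'x \<Rightarrow> 'x \<Rightarrow> real)" where
  "exterior_derivative \<omega> = (\<lambda>x u v.
     frechet_derivative (\<lambda>y. \<omega> y v) (at x) u - frechet_derivative (\<lambda>y. \<omega> y u) (at x) v)"


section \<open>The two cases together\<close>

text \<open>\<open>'x\<close> is the vector space containing the objects, and \<open>'v\<close> the space in which the simplices of a
  triangulation live. A smooth manifold is given as an open subset of \<open>'x\<close>; the flat one is the
  whole space.\<close>

datatype ('x, 'v) space =
    Discrete (cells: "'v set set") (orientation: "'v set \<Rightarrow> 'v list")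
  | Continuous (carrier_set: "'x set")

datatype ('x, 'v) one_chain =
    Simplicial_Chain (simplicial_part: "'v set real_chain")
  | Singular_Chain (singular_part: "(real \<Rightarrow> 'x) real_chain")

datatype ('x, 'v) one_form =
    Cochain_1 "'v set real_chain \<Rightarrow> real"
  | Differential_1 "'x \<Rightarrow> 'x \<Rightarrow> real"

datatype ('x, 'v) two_form =
    Cochain_2 "'v set real_chain \<Rightarrow> real"
  | Differential_2 "'x \<Rightarrow> 'x \<Rightarrow> 'x \<Rightarrow> real"

fun is_space :: "('x::euclidean_space, 'v::euclidean_space) space \<Rightarrow> bool" where
  "is_space (Discrete K ord) \<longleftrightarrow> geometric_complex K \<and> orientation_of K ord"
| "is_space (Continuous U) \<longleftrightarrow> open U"

fun flat :: "('x::euclidean_space, 'v::euclidean_space) space \<Rightarrow> bool" where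
  "flat (Discrete K ord) \<longleftrightarrow> \<Union>K homeomorphic (UNIV :: 'x set)"
| "flat (Continuous U) \<longleftrightarrow> U = UNIV"

fun one_chains ::
    "('x::euclidean_space, 'v::euclidean_space) space \<Rightarrow> ('x, 'v) one_chain set" where
  "one_chains (Discrete K ord) = Simplicial_Chain ` simplicial_chains 1 K"
| "one_chains (Continuous U) = Singular_Chain ` singular_1_chains U"

fun loops :: "('x::euclidean_space, 'v::euclidean_space) space \<Rightarrow> ('x, 'v) one_chain set" where
  "loops (Discrete K ord) =
     Simplicial_Chain ` {c \<in> simplicial_chains 1 K. simplicial_boundary ord c = 0}"
| "loops (Continuous U) =
     Singular_Chain ` {c \<in> singular_1_chains U. singular_boundary c = 0}"

fun combination ::
    "('x, 'v) space \<Rightarrow> ('x \<Rightarrow> real) \<Rightarrow> ('x \<Rightarrow> ('x, 'v) one_chain) \<Rightarrow> 'x set \<Rightarrow> ('x, 'v) one_chain"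
where
  "combination (Discrete K ord) b ket A =
     Simplicial_Chain (\<Sum>x\<in>A. b x *\<^sub>R simplicial_part (ket x))"
| "combination (Continuous U) b ket A =
     Singular_Chain (\<Sum>x\<in>A. b x *\<^sub>R singular_part (ket x))"

text \<open>Every linear functional on the \<open>n\<close>-chains of a complex extends to all formal combinations of
  sets; only its values on chains of the complex are ever used.\<close>

fun is_one_form ::
    "('x::euclidean_space, 'v::euclidean_space) space \<Rightarrow> ('x, 'v) one_form \<Rightarrow> bool" where
  "is_one_form (Discrete K ord) (Cochain_1 \<phi>) \<longleftrightarrow> linear \<phi>"
| "is_one_form (Continuous U) (Differential_1 \<omega>) \<longleftrightarrow> smooth_1_form_on U \<omega>"
| "is_one_form _ _ \<longleftrightarrow> False"

text \<open>The mixed cases below do not occur for forms and chains on the same space.\<close>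

fun pairing :: "('x::euclidean_space, 'v) one_form \<Rightarrow> ('x, 'v) one_chain \<Rightarrow> real" where
  "pairing (Cochain_1 \<phi>) (Simplicial_Chain c) = \<phi> c"
| "pairing (Differential_1 \<omega>) (Singular_Chain c) = linear_extension (curve_integral \<omega>) c"
| "pairing _ _ = 0"

fun curvature ::
    "('x::euclidean_space, 'v::euclidean_space) space \<Rightarrow> ('x, 'v) one_form \<Rightarrow> ('x, 'v) two_form"
where
  "curvature M (Cochain_1 \<phi>) = Cochain_2 (simplicial_coboundary (orientation M) \<phi>)"
| "curvature M (Differential_1 \<omega>) = Differential_2 (exterior_derivative \<omega>)"

fun is_zero_two_form ::
    "('x::euclidean_space, 'v::euclidean_space) space \<Rightarrow> ('x, 'v) two_form \<Rightarrow> bool" where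
  "is_zero_two_form (Discrete K ord) (Cochain_2 \<psi>) \<longleftrightarrow> (\<forall>c\<in>simplicial_chains 2 K. \<psi> c = 0)"
| "is_zero_two_form (Continuous U) (Differential_2 F) \<longleftrightarrow> (\<forall>x\<in>U. \<forall>u v. F x u v = 0)"
| "is_zero_two_form _ _ \<longleftrightarrow> False"


section \<open>Ontic representations of generalized probability theories\<close>

text \<open>\<open>ket x\<close> is the object \<open>x\<close> viewed as a 1-chain; linear relations among objects become loops.\<close>

definition encoding ::
    "('x::euclidean_space, 'v::euclidean_space) space \<Rightarrow> 'x set \<Rightarrow> ('x \<Rightarrow> ('x, 'v) one_chain) \<Rightarrow> bool"
where
  "encoding M X ket \<longleftrightarrow>
     is_space M \<and>
     (\<forall>x\<in>X. ket x \<in> one_chains M) \<and>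
     (\<forall>A b. finite A \<and> A \<subseteq> X \<and> (\<Sum>x\<in>A. b x *\<^sub>R x) = 0 \<longrightarrow> combination M b ket A \<in> loops M)"

record ('e, 'u, 't, 'v, 'p, 'w, 'l) ontic_structure =
  effects :: "'e set"
  transformations :: "'t set"
  states :: "'p set"
  prob :: "'e \<Rightarrow> 't \<Rightarrow> 'p \<Rightarrow> real"
  effect_space :: "('e, 'u) space"
  transformation_space :: "('t, 'v) space"
  state_space :: "('p, 'w) space"
  effect_ket :: "'e \<Rightarrow> ('e, 'u) one_chain"
  transformation_ket :: "'t \<Rightarrow> ('t, 'v) one_chain"
  state_ket :: "'p \<Rightarrow> ('p, 'w) one_chain"
  ontic_set :: "'l set"
  xi :: "'l \<Rightarrow> ('e, 'u) one_form"
  Gamma :: "'l \<Rightarrow> 'l \<Rightarrow> ('t, 'v) one_form"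
  mu :: "'l \<Rightarrow> ('p, 'w) one_form"

text \<open>The arguments of \<open>Gamma\<close> are ordered \<open>\<lambda>'\<close>, \<open>\<lambda>\<close>. The ontic set may be infinite, hence
  \<open>has_sum\<close>; for a finite ontic set this is the ordinary sum.\<close>

definition ontic_representation ::
    "('e::euclidean_space, 'u::euclidean_space, 't::euclidean_space, 'v::euclidean_space,
      'p::euclidean_space, 'w::euclidean_space, 'l) ontic_structure \<Rightarrow> bool" where
  "ontic_representation R \<longleftrightarrow>
     convex (effects R) \<and> convex (transformations R) \<and> convex (states R) \<and>
     (\<forall>E\<in>effects R. \<forall>T\<in>transformations R. \<forall>P\<in>states R. prob R E T P \<in> {0..1}) \<and>
     encoding (effect_space R) (effects R) (effect_ket R) \<and>
     encoding (transformation_space R) (transformations R) (transformation_ket R) \<and>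
     encoding (state_space R) (states R) (state_ket R) \<and>
     (\<forall>l'\<in>ontic_set R. is_one_form (effect_space R) (xi R l')) \<and>
     (\<forall>l'\<in>ontic_set R. \<forall>l\<in>ontic_set R. is_one_form (transformation_space R) (Gamma R l' l)) \<and>
     (\<forall>l\<in>ontic_set R. is_one_form (state_space R) (mu R l)) \<and>
     (\<forall>l'\<in>ontic_set R. \<forall>E\<in>effects R. pairing (xi R l') (effect_ket R E) \<in> {0..1}) \<and>
     (\<forall>l'\<in>ontic_set R. \<forall>l\<in>ontic_set R. \<forall>T\<in>transformations R.
        pairing (Gamma R l' l) (transformation_ket R T) \<in> {0..1}) \<and>
     (\<forall>l\<in>ontic_set R. \<forall>P\<in>states R. pairing (mu R l) (state_ket R P) \<in> {0..1}) \<and>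
     (\<forall>E\<in>effects R. \<forall>T\<in>transformations R. \<forall>P\<in>states R.
        ((\<lambda>(l, l'). pairing (xi R l') (effect_ket R E) *
                    pairing (Gamma R l' l) (transformation_ket R T) *
                    pairing (mu R l) (state_ket R P))
          has_sum prob R E T P) (ontic_set R \<times> ontic_set R))"

definition flat_representation ::
    "('e::euclidean_space, 'u::euclidean_space, 't::euclidean_space, 'v::euclidean_space,
      'p::euclidean_space, 'w::euclidean_space, 'l) ontic_structure \<Rightarrow> bool" where
  "flat_representation R \<longleftrightarrow>
     flat (effect_space R) \<and> flat (transformation_space R) \<and> flat (state_space R)"

definition noncontextual_for_measurements ::
    "('e::euclidean_space, 'u::euclidean_space, 't::euclidean_space, 'v::euclidean_space,
      'p::euclidean_space, 'w::euclidean_space, 'l) ontic_structure \<Rightarrow> bool" where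
  "noncontextual_for_measurements R \<longleftrightarrow>
     (\<forall>\<gamma>\<in>loops (effect_space R). \<forall>l'\<in>ontic_set R. pairing (xi R l') \<gamma> = 0)"

definition noncontextual_for_transformations ::
    "('e::euclidean_space, 'u::euclidean_space, 't::euclidean_space, 'v::euclidean_space,
      'p::euclidean_space, 'w::euclidean_space, 'l) ontic_structure \<Rightarrow> bool" where
  "noncontextual_for_transformations R \<longleftrightarrow>
     (\<forall>\<gamma>\<in>loops (transformation_space R). \<forall>l\<in>ontic_set R. \<forall>l'\<in>ontic_set R.
        pairing (Gamma R l' l) \<gamma> = 0)"

definition noncontextual_for_states ::
    "('e::euclidean_space, 'u::euclidean_space, 't::euclidean_space, 'v::euclidean_space,
      'p::euclidean_space, 'w::euclidean_space, 'l) ontic_structure \<Rightarrow> bool" where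
  "noncontextual_for_states R \<longleftrightarrow>
     (\<forall>\<gamma>\<in>loops (state_space R). \<forall>l\<in>ontic_set R. pairing (mu R l) \<gamma> = 0)"

end

theory Submission
  imports Defs
begin

text \<open>The three claims are instances of one equivalence for a 1-form on a flat space. Zero phases on
  loops give zero curvature because small closed circuits (boundaries of triangles, respectively
  parallelograms) detect the coboundary. Conversely a closed form on a flat space has a potential.
  In the continuous case this is the Poincare lemma. In the discrete case the homeomorphism
  with \<open>\<real>\<^sup>n\<close> is not simplicial, so the cocycle is spread to a function \<open>A x y\<close> of nearby points of
  \<open>\<real>\<^sup>n\<close> that satisfies the cocycle identity locally, and \<open>A\<close> is summed along rays from the origin.\<close>

section \<open>Linear extensions\<close>

text \<open>A cocycle is additive only on vertices of a common simplex, and rays in Euclidean space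
  pay no attention to simplices. Assigning a vertex to every point resolves this, but only at a
  small scale, since nearby points must receive vertices of a common simplex. A uniform scale
  requires compactness. It is available because a chain has finite support: its edges map into one
  ball, and a potential that depends on the ball is enough. Both cases then contract to the origin,
  by an integral or by a finite sum; closedness is used on the cone over a curve or in the thin
  strip between two rays. A further difficulty is that the image of an edge may be long compared
  with the scale. It is cut into short pieces, which is harmless because only the two ends of the
  edge are ever assigned to its points. For the opposite implication, parallelograms suit
  differential forms better than triangles: opposite sides have the same direction vector, so their
  integrands can be subtracted pointwise.\<close>

lemma linear_extension_superset:
  assumes "finite A" "Poly_Mapping.keys c \<subseteq> A"
  shows "linear_extension f c = (\<Sum>s\<in>A. Poly_Mapping.lookup c s *\<^sub>R f s)"
  unfolding linear_extension_def
  by (rule sum.mono_neutral_left) (use assms in \<open>auto simp: in_keys_iff\<close>)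

lemma lookup_scaleR [simp]:
  "Poly_Mapping.lookup (r *\<^sub>R c) s = r *\<^sub>R Poly_Mapping.lookup c s"
  by transfer simp

lemma linear_linear_extension: "linear (linear_extension f)"
proof (rule linearI)
  fix c d :: "'a real_chain"
  let ?A = "Poly_Mapping.keys c \<union> Poly_Mapping.keys d"
  have "Poly_Mapping.keys (c + d) \<subseteq> ?A"
    by (rule Poly_Mapping.keys_add)
  then show "linear_extension f (c + d) = linear_extension f c + linear_extension f d"
    by (simp add: linear_extension_superset[of ?A] lookup_add scaleR_add_left sum.distrib)
next
  fix r :: real and c :: "'a real_chain"
  have "Poly_Mapping.keys (r *\<^sub>R c) \<subseteq> Poly_Mapping.keys c"
    by (auto simp: in_keys_iff)
  then show "linear_extension f (r *\<^sub>R c) = r *\<^sub>R linear_extension f c"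
    by (simp add: linear_extension_superset[of "Poly_Mapping.keys c"] scaleR_sum_right)
qed

lemma linear_extension_single [simp]:
  "linear_extension f (Poly_Mapping.single s r) = r *\<^sub>R f s"
  by (subst linear_extension_superset[of "{s}"]) auto

lemma linear_extension_cong:
  "(\<And>s. s \<in> Poly_Mapping.keys c \<Longrightarrow> f s = g s) \<Longrightarrow> linear_extension f c = linear_extension g c"
  by (simp add: linear_extension_def)

lemma linear_linear_extension_eq:
  assumes "linear \<phi>"
  shows "\<phi> (linear_extension f c) = linear_extension (\<lambda>s. \<phi> (f s)) c"
  by (simp add: linear_extension_def linear_sum[OF assms] linear_scale[OF assms])

lemma linear_extension_basis: "linear_extension (\<lambda>s. Poly_Mapping.single s 1) c = c"
proof (rule poly_mapping_eqI)
  fix t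
  have "Poly_Mapping.lookup (linear_extension (\<lambda>s. Poly_Mapping.single s 1) c) t =
        (\<Sum>s\<in>Poly_Mapping.keys c. if s = t then Poly_Mapping.lookup c s else 0)"
    unfolding linear_extension_def lookup_sum
    by (intro sum.cong) (auto simp: lookup_single when_def)
  also have "\<dots> = Poly_Mapping.lookup c t"
    by (simp add: sum.delta in_keys_iff)
  finally show "Poly_Mapping.lookup (linear_extension (\<lambda>s. Poly_Mapping.single s 1) c) t =
      Poly_Mapping.lookup c t" .
qed

lemma linear_chain_expansion:
  assumes "linear \<phi>"
  shows "\<phi> c = linear_extension (\<lambda>s. \<phi> (Poly_Mapping.single s 1)) c"
  using linear_linear_extension_eq[OF assms, of "\<lambda>s. Poly_Mapping.single s 1" c]
  by (simp add: linear_extension_basis)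

section \<open>Boundaries of edges and triangles\<close>

text \<open>Distinctness makes the rearranging permutation unique, so the definite description in
  \<open>relative_sign\<close> can be evaluated at any known witness.\<close>

lemma relative_sign_permute_list:
  assumes "distinct xs" "p permutes {..<length xs}" "permute_list p xs = ys"
  shows "relative_sign xs ys = of_int (sign p)"
proof -
  have "q = p" if q: "q permutes {..<length xs}" "permute_list q xs = ys" for q
  proof
    fix i
    show "q i = p i"
    proof (cases "i < length xs")
      case True
      then have "xs ! q i = xs ! p i"
        using q assms permute_list_nth by metis
      moreover have "q i < length xs" "p i < length xs"
        using True permutes_in_image[OF q(1), of i] permutes_in_image[OF assms(2), of i] by auto
      ultimately show ?thesis
        using assms(1) nth_eq_iff_index_eq by blast
    next
      case False
      then show ?thesis
        using q(1) assms(2) by (simp add: permutes_def)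
    qed
  qed
  then have "(THE q. q permutes {..<length xs} \<and> permute_list q xs = ys) = p"
    using assms by blast
  then show ?thesis
    by (simp add: relative_sign_def)
qed

lemma relative_sign_refl: "distinct xs \<Longrightarrow> relative_sign xs xs = 1"
  by (subst relative_sign_permute_list[where p = id]) (auto simp: permutes_id)

lemma relative_sign_swap:
  assumes "a \<noteq> b"
  shows "relative_sign [a, b] [b, a] = -1"
proof -
  have "Transposition.transpose 0 1 permutes {..<length [a, b]}"
    by (rule permutes_swap_id) auto
  moreover have "permute_list (Transposition.transpose 0 1) [a, b] = [b, a]"
    by (simp add: permute_list_def upt_rec)
  ultimately show ?thesis
    using assms by (subst relative_sign_permute_list) (auto simp: sign_swap_id)
qed

section \<open>Faces and vertices of a geometric complex\<close>

lemma geometric_complexD: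
  assumes "geometric_complex K" "S \<in> K"
  shows geometric_complex_simplex: "\<exists>n. n simplex S"
    and geometric_complex_face: "F face_of S \<Longrightarrow> F \<in> K"
    and geometric_complex_Int: "T \<in> K \<Longrightarrow> (S \<inter> T) face_of S"
    and geometric_complex_locally_finite:
      "x \<in> S \<Longrightarrow> \<exists>U. open U \<and> x \<in> U \<and> finite {S \<in> K. S \<inter> U \<noteq> {}}"
proof -
  note K = assms(1)[unfolded geometric_complex_def]
  show "\<exists>n. n simplex S" "F face_of S \<Longrightarrow> F \<in> K" "T \<in> K \<Longrightarrow> (S \<inter> T) face_of S"
    using K assms(2) by simp_all
  show "\<exists>U. open U \<and> x \<in> U \<and> finite {S \<in> K. S \<inter> U \<noteq> {}}" if "x \<in> S"
    using K UnionI[OF assms(2) that] by (elim conjE) (rule bspec)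
qed

text \<open>Simplices of a complex meet in faces, so a vertex of the complex that lies in
  \<open>S\<close> is a face of \<open>S\<close>. This turns the position of a point into
  combinatorial information.\<close>

lemma vertex_extreme_point:
  assumes "geometric_complex K" "{v} \<in> K" "S \<in> K" "v \<in> S"
  shows "v extreme_point_of S"
proof -
  have "(S \<inter> {v}) face_of S"
    using assms(1-3) by (intro geometric_complex_Int)
  moreover have "S \<inter> {v} = {v}"
    using assms(4) by blast
  ultimately show ?thesis
    by (simp add: face_of_singleton)
qed

lemma extreme_point_vertex:
  assumes "geometric_complex K" "S \<in> K" "v extreme_point_of S"
  shows "{v} \<in> K"
  using assms geometric_complex_face by (auto simp flip: face_of_singleton)

lemma convex_hull_extreme_points_face:
  assumes "geometric_complex K" "S \<in> K" "C \<subseteq> {v. v extreme_point_of S}"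
  shows "convex hull C \<in> K" "\<not> affine_dependent C"
proof -
  obtain D where D: "\<not> affine_dependent D" "S = convex hull D"
    using geometric_complex_simplex[OF assms(1,2)] by (auto simp: simplex_def)
  then have "C \<subseteq> D"
    using assms(3) by (auto simp: extreme_point_of_convex_hull_affine_independent)
  then have "(convex hull C) face_of S"
    using D face_of_convex_hull_affine_independent by blast
  then show "convex hull C \<in> K"
    by (rule geometric_complex_face[OF assms(1,2)])
  show "\<not> affine_dependent C"
    using \<open>C \<subseteq> D\<close> D(1) affine_independent_subset by blast
qed

lemma ord_simplex:
  assumes "orientation_of K ord" "S \<in> K" "int n simplex S"
  shows "distinct (ord S)" "set (ord S) = {v. v extreme_point_of S}"
    "length (ord S) = Suc n" "S = convex hull (set (ord S))"
proof -
  obtain C where C: "\<not> affine_dependent C" "int (card C) = int n + 1" "S = convex hull C"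
    using assms(3) unfolding simplex_def by blast
  have *: "distinct (ord S)" "set (ord S) = {v. v extreme_point_of S}"
    using assms by (auto simp: orientation_of_def)
  then have "set (ord S) = C"
    using C by (auto simp: extreme_point_of_convex_hull_affine_independent)
  then show "length (ord S) = Suc n" "S = convex hull (set (ord S))"
    using C distinct_card[OF *(1)] by auto
  show "distinct (ord S)" "set (ord S) = {v. v extreme_point_of S}"
    using * by auto
qed

lemma two_element_list:
  assumes "distinct xs" "set xs = {a, b}" "a \<noteq> b"
  shows "xs = [a, b] \<or> xs = [b, a]"
proof -
  have "length xs = 2"
    using assms distinct_card[OF assms(1)] by simp
  then obtain x y where "xs = [x, y]"
    by (auto simp: numeral_2_eq_2 length_Suc_conv)
  then show ?thesis
    using assms by (auto simp: doubleton_eq_iff)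
qed

lemma ord_edge:
  assumes "orientation_of K ord" "convex hull {a, b} \<in> K" "a \<noteq> b"
  shows "ord (convex hull {a, b}) = [a, b] \<or> ord (convex hull {a, b}) = [b, a]"
proof (rule two_element_list)
  show "distinct (ord (convex hull {a, b}))" "set (ord (convex hull {a, b})) = {a, b}"
    using assms(1,2)
    by (auto simp: orientation_of_def extreme_point_of_convex_hull_2)
qed fact

lemma ord_vertex:
  assumes "orientation_of K ord" "{a} \<in> K"
  shows "ord {a} = [a]"
proof -
  \<comment> \<open>The singleton is treated as the degenerate segment from \<open>a\<close> to
    \<open>a\<close>.\<close>
  have "distinct (ord {a})" "set (ord {a}) = {a}"
    using assms extreme_point_of_segment[of _ a a] by (auto simp: orientation_of_def)
  then have "length (ord {a}) = 1"
    using distinct_card by fastforce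
  then show ?thesis
    using \<open>set (ord {a}) = {a}\<close> by (auto simp: length_Suc_conv)
qed

text \<open>The ordered edge \<open>[a, b]\<close> as a chain. The sign compensates for the stored
  orientation, so later identities do not depend on the order chosen by \<open>ord\<close>. The
  value 0 for \<open>a = b\<close> admits degenerate triangles, which arise when nearby points are
  assigned the same vertex.\<close>

definition oriented_edge ::
    "('v::euclidean_space set \<Rightarrow> 'v list) \<Rightarrow> 'v \<Rightarrow> 'v \<Rightarrow> 'v set real_chain" where
  "oriented_edge ord a b =
     (if a = b then 0
      else Poly_Mapping.single (convex hull {a, b})
             (relative_sign (ord (convex hull {a, b})) [a, b]))"

lemma oriented_edge_same [simp]: "oriented_edge ord a a = 0"
  by (simp add: oriented_edge_def)

lemma oriented_edge_commute:
  assumes "orientation_of K ord" "convex hull {a, b} \<in> K"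
  shows "oriented_edge ord b a = - oriented_edge ord a b"
proof (cases "a = b")
  case False
  have "relative_sign (ord (convex hull {a, b})) [b, a] =
        - relative_sign (ord (convex hull {a, b})) [a, b]"
    using ord_edge[OF assms False] False relative_sign_swap[of a b] relative_sign_swap[of b a]
      relative_sign_refl[of "[a, b]"] relative_sign_refl[of "[b, a]"] by auto
  then show ?thesis
    using False by (simp add: oriented_edge_def insert_commute single_uminus)
qed simp

section \<open>Boundary formulas, and boundaries as loops\<close>

lemma linear_simplicial_boundary: "linear (simplicial_boundary ord)"
  by (simp add: simplicial_boundary_def linear_linear_extension)

lemma one_simplex_vertices:
  assumes "geometric_complex K" "orientation_of K ord" "S \<in> K" "1 simplex S"
  obtains a b where "ord S = [a, b]" "a \<noteq> b" "S = convex hull {a, b}" "{a} \<in> K" "{b} \<in> K"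
proof -
  note o = ord_simplex[OF assms(2,3), of 1, unfolded of_nat_1, OF assms(4)]
  then obtain a b where "ord S = [a, b]"
    by (auto simp: length_Suc_conv)
  moreover from this have "a extreme_point_of S" "b extreme_point_of S"
    using o(2) by auto
  moreover have "a \<noteq> b" "S = convex hull {a, b}"
    using o(1,4) \<open>ord S = [a, b]\<close> by (simp_all del: o(2))
  ultimately show ?thesis
    using that extreme_point_vertex[OF assms(1,3)] by metis
qed

lemma simplex_boundary_edge:
  assumes "orientation_of K ord" "ord S = [a, b]" "{a} \<in> K" "{b} \<in> K"
  shows "simplex_boundary ord S = Poly_Mapping.single {b} 1 - Poly_Mapping.single {a} 1"
  using ord_vertex[OF assms(1,3)] ord_vertex[OF assms(1,4)] relative_sign_refl[of "[a]"]
    relative_sign_refl[of "[b]"]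
  by (simp add: simplex_boundary_def assms(2) single_uminus)

lemma boundary_oriented_edge:
  assumes K: "geometric_complex K" "orientation_of K ord" and ab: "convex hull {a, b} \<in> K"
  shows "simplicial_boundary ord (oriented_edge ord a b) =
         Poly_Mapping.single {b} 1 - Poly_Mapping.single {a} 1"
proof (cases "a = b")
  case True
  then show ?thesis
    by (simp add: linear_0[OF linear_simplicial_boundary])
next
  case False
  let ?S = "convex hull {a, b}"
  have v: "{a} \<in> K" "{b} \<in> K"
    using extreme_point_vertex[OF K(1) ab] by (auto simp: extreme_point_of_convex_hull_2)
  have "simplicial_boundary ord (oriented_edge ord a b) =
        relative_sign (ord ?S) [a, b] *\<^sub>R simplex_boundary ord ?S"
    using False by (simp add: oriented_edge_def simplicial_boundary_def)
  then show ?thesis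
    using ord_edge[OF K(2) ab False] False v relative_sign_swap[of b a]
      relative_sign_refl[of "[a, b]"] simplex_boundary_edge[OF K(2)]
    by auto
qed

lemma simplex_boundary_triangle:
  assumes "ord S = [a, b, c]" "distinct [a, b, c]"
  shows "simplex_boundary ord S =
         oriented_edge ord b c - oriented_edge ord a c + oriented_edge ord a b"
  using assms
  by (simp add: simplex_boundary_def oriented_edge_def lessThan_Suc single_uminus
      eval_nat_numeral Let_def insert_commute)

lemma two_simplex_vertices:
  assumes "geometric_complex K" "orientation_of K ord" "S \<in> K" "2 simplex S"
  obtains a b c where "ord S = [a, b, c]" "distinct [a, b, c]"
    "convex hull {a, b} \<in> K" "convex hull {b, c} \<in> K" "convex hull {a, c} \<in> K"
    "1 simplex (convex hull {a, b})" "1 simplex (convex hull {b, c})"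
    "1 simplex (convex hull {a, c})"
proof -
  note o = ord_simplex[OF assms(2,3), of 2, unfolded of_nat_numeral, OF assms(4)]
  then obtain a b c where abc: "ord S = [a, b, c]"
    by (auto simp: length_Suc_conv eval_nat_numeral)
  have d: "distinct [a, b, c]"
    using abc o(1) by simp
  have e: "{a, b, c} \<subseteq> {v. v extreme_point_of S}"
    using o(2) by (simp add: abc)
  have "convex hull {x, y} \<in> K" if "{x, y} \<subseteq> {a, b, c}" for x y
    by (rule convex_hull_extreme_points_face(1)[OF assms(1,3) order_trans[OF that e]])
  moreover have "1 simplex (convex hull {x, y})" if "x \<noteq> y" for x y :: 'a
    using one_simplex_segment[OF that] by (simp add: segment_convex_hull)
  ultimately show ?thesis
    using that[OF abc d] d by auto
qed

lemma simplicial_boundary_triangle: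
  assumes "geometric_complex K" "orientation_of K ord" "S \<in> K" "2 simplex S"
  shows "simplex_boundary ord S \<in> simplicial_chains 1 K"
    and "simplicial_boundary ord (simplex_boundary ord S) = 0"
proof -
  obtain a b c where abc: "ord S = [a, b, c]" "distinct [a, b, c]"
    and f: "convex hull {a, b} \<in> K" "convex hull {b, c} \<in> K" "convex hull {a, c} \<in> K"
    and s: "1 simplex (convex hull {a, b})" "1 simplex (convex hull {b, c})"
      "1 simplex (convex hull {a, c})"
    using two_simplex_vertices[OF assms] by blast
  note b = simplex_boundary_triangle[of ord S, OF abc]
  have k: "Poly_Mapping.keys (oriented_edge ord x y) \<subseteq> {convex hull {x, y}}" for x y
    by (simp add: oriented_edge_def)
  have "Poly_Mapping.keys (simplex_boundary ord S) \<subseteq>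
        {convex hull {b, c}, convex hull {a, c}, convex hull {a, b}}"
  proof
    fix T
    assume "T \<in> Poly_Mapping.keys (simplex_boundary ord S)"
    then have "T \<in> Poly_Mapping.keys (oriented_edge ord b c) \<or>
        T \<in> Poly_Mapping.keys (oriented_edge ord a c) \<or> T \<in> Poly_Mapping.keys (oriented_edge ord a b)"
      unfolding b by (auto simp: in_keys_iff lookup_add lookup_minus)
    then show "T \<in> {convex hull {b, c}, convex hull {a, c}, convex hull {a, b}}"
      using k by blast
  qed
  then show "simplex_boundary ord S \<in> simplicial_chains 1 K"
    using f s by (auto simp: simplicial_chains_def)
  show "simplicial_boundary ord (simplex_boundary ord S) = 0"
    unfolding b using f
    by (simp add: linear_add[OF linear_simplicial_boundary] linear_diff[OF linear_simplicial_boundary]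
        boundary_oriented_edge[OF assms(1,2)])
qed

text \<open>Every boundary of a 2-chain is thereby a loop, which is how zero phases force a zero
  coboundary.\<close>

lemma simplicial_boundary_boundary:
  assumes "geometric_complex K" "orientation_of K ord" "c \<in> simplicial_chains 2 K"
  shows "simplicial_boundary ord c \<in> simplicial_chains 1 K"
    and "simplicial_boundary ord (simplicial_boundary ord c) = 0"
proof -
  have S: "S \<in> K \<and> 2 simplex S" if "S \<in> Poly_Mapping.keys c" for S
    using assms(3) that by (auto simp: simplicial_chains_def)
  have "S \<in> K \<and> 1 simplex S" if "S \<in> Poly_Mapping.keys (simplicial_boundary ord c)" for S
  proof -
    have "\<exists>T\<in>Poly_Mapping.keys c. Poly_Mapping.lookup (simplex_boundary ord T) S \<noteq> 0"
    proof (rule ccontr)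
      assume "\<not> ?thesis"
      then have "Poly_Mapping.lookup (simplicial_boundary ord c) S = 0"
        by (simp add: simplicial_boundary_def linear_extension_def lookup_sum)
      with that show False
        by (simp add: in_keys_iff)
    qed
    then show ?thesis
      using simplicial_boundary_triangle(1)[OF assms(1,2)] S
      by (fastforce simp: simplicial_chains_def in_keys_iff)
  qed
  then show "simplicial_boundary ord c \<in> simplicial_chains 1 K"
    by (simp add: simplicial_chains_def)
  have "simplicial_boundary ord (simplicial_boundary ord c) =
        linear_extension (\<lambda>S. simplicial_boundary ord (simplex_boundary ord S)) c"
    by (subst (2) simplicial_boundary_def)
       (rule linear_linear_extension_eq[OF linear_simplicial_boundary])
  also have "\<dots> = linear_extension (\<lambda>_. 0) c"
    by (rule linear_extension_cong) (use S simplicial_boundary_triangle(2)[OF assms(1,2)] in blast)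
  finally show "simplicial_boundary ord (simplicial_boundary ord c) = 0"
    by (simp add: linear_extension_def)
qed

text \<open>Three distinct vertices of \<open>S\<close> span a triangle of \<open>K\<close>, on
  which the coboundary of \<open>\<phi>\<close> vanishes; if two of them coincide, antisymmetry of
  the oriented edges suffices. The simplex \<open>S\<close> may have any dimension.\<close>

lemma cocycle_triangle:
  assumes K: "geometric_complex K" "orientation_of K ord" and "linear \<phi>"
    and closed: "\<And>c. c \<in> simplicial_chains 2 K \<Longrightarrow> simplicial_coboundary ord \<phi> c = 0"
    and S: "S \<in> K" "{a, b, c} \<subseteq> {v. v extreme_point_of S}"
  shows "\<phi> (oriented_edge ord a b) + \<phi> (oriented_edge ord b c) = \<phi> (oriented_edge ord a c)"
proof -
  have face: "convex hull {x, y} \<in> K" if "{x, y} \<subseteq> {a, b, c}" for x y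
    by (rule convex_hull_extreme_points_face(1)[OF K(1) S(1) order_trans[OF that S(2)]])
  have anti: "\<phi> (oriented_edge ord y x) = - \<phi> (oriented_edge ord x y)"
    if "{x, y} \<subseteq> {a, b, c}" for x y
    using oriented_edge_commute[OF K(2) face[OF that]] linear_neg[OF \<open>linear \<phi>\<close>] by metis
  show ?thesis
  proof (cases "distinct [a, b, c]")
    case False
    then show ?thesis
      using anti[of a b] anti[of b c] linear_0[OF \<open>linear \<phi>\<close>] by auto
  next
    case True
    let ?T = "convex hull {a, b, c}"
    have T: "?T \<in> K" "\<not> affine_dependent {a, b, c}"
      using convex_hull_extreme_points_face[OF K(1) S] by auto
    have T2: "2 simplex ?T"
      by (rule simplex_convex_hull) (use T(2) True in auto)
    have "simplicial_coboundary ord \<phi> (Poly_Mapping.single ?T 1) = 0"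
      using T(1) T2 by (intro closed) (simp add: simplicial_chains_def)
    then have z: "\<phi> (simplex_boundary ord ?T) = 0"
      by (simp add: simplicial_coboundary_def simplicial_boundary_def)
    obtain x y z where xyz: "ord ?T = [x, y, z]" "distinct [x, y, z]"
      using two_simplex_vertices[OF K T(1) T2] by metis
    have "set (ord ?T) = {a, b, c}"
      using ord_simplex(2)[OF K(2) T(1), of 2] T2 T(2)
      by (auto simp: extreme_point_of_convex_hull_affine_independent)
    then have s: "{x, y, z} = {a, b, c}"
      using xyz by simp
    have "\<phi> (oriented_edge ord y z) - \<phi> (oriented_edge ord x z) + \<phi> (oriented_edge ord x y) = 0"
      using z simplex_boundary_triangle[of ord ?T, OF xyz] \<open>linear \<phi>\<close>
      by (simp add: linear_add linear_diff)
    moreover have "x \<in> {a, b, c}" "y \<in> {a, b, c}" "z \<in> {a, b, c}"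
      using s by blast+
    \<comment> \<open>\<open>x, y, z\<close> is one of the six orderings of \<open>a, b, c\<close>;
      antisymmetry brings the boundary relation of each into the required form.\<close>
    ultimately show ?thesis
      using xyz(2) True anti[of a b] anti[of b c] anti[of a c] by auto
  qed
qed

section \<open>Cocycles on a triangulation of a Euclidean space\<close>

text \<open>The radial steps towards two close points form a ladder. A diagonal splits each cell
  into two triangles, and the cocycle identity on both makes the sums along the two rails differ by
  the top rung. At the origin the rails meet, and the bottom rung is
  \<open>A 0 0 = 0\<close>.\<close>

lemma local_cocycle_potential:
  fixes A :: "'a::real_normed_vector \<Rightarrow> 'a \<Rightarrow> real"
  assumes "0 < \<epsilon>"
    and cocycle: "\<And>x y z. \<lbrakk>x \<in> cball 0 r; y \<in> cball 0 r; z \<in> cball 0 r;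
      dist x y < \<epsilon>; dist y z < \<epsilon>; dist x z < \<epsilon>\<rbrakk> \<Longrightarrow> A x y + A y z = A x z"
  shows "\<exists>f. \<exists>\<delta>>0. \<forall>x\<in>cball 0 r. \<forall>y\<in>cball 0 r. dist x y < \<delta> \<longrightarrow> f y - f x = A x y"
proof -
  \<comment> \<open>Rungs and steps shorter than \<open>\<epsilon> / 2\<close> give diagonals
    shorter than \<open>\<epsilon>\<close>, which fixes the number of steps. \<open>Suc\<close>
    keeps that number positive, and the absolute value covers a negative radius.\<close>
  obtain n :: nat where n: "2 * \<bar>r\<bar> / \<epsilon> < real n"
    using reals_Archimedean2 by blast
  define N where "N = Suc n"
  have N: "\<bar>r\<bar> / N < \<epsilon> / 2" "N > 0"
    using n \<open>0 < \<epsilon>\<close> by (auto simp: N_def field_simps)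
  define p where "p x i = (real i / N) *\<^sub>R x" for x :: 'a and i
  define f where "f x = (\<Sum>i<N. A (p x i) (p x (Suc i)))" for x
  have p_in: "p x i \<in> cball 0 r" if "x \<in> cball 0 r" "i \<le> N" for x i
  proof -
    have "norm (p x i) \<le> 1 * norm x"
      unfolding p_def norm_scaleR by (rule mult_right_mono) (use that N in \<open>auto simp: field_simps\<close>)
    then show ?thesis
      using that by simp
  qed
  have p_step: "dist (p x i) (p x (Suc i)) < \<epsilon> / 2" if "x \<in> cball 0 r" for x i
  proof -
    have "p x i - p x (Suc i) = (- 1 / N) *\<^sub>R x"
      by (simp add: p_def flip: scaleR_diff_left) (simp add: diff_divide_distrib[symmetric])
    then have "dist (p x i) (p x (Suc i)) = norm x / N"
      by (simp add: dist_norm)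
    also have "\<dots> \<le> \<bar>r\<bar> / N"
      using that by (intro divide_right_mono) auto
    finally show ?thesis
      using N(1) by linarith
  qed
  have p_dist: "dist (p x i) (p y i) \<le> dist x y" if "i \<le> N" for x y i
  proof -
    have "dist (p x i) (p y i) = (real i / N) * dist x y"
      by (simp add: p_def dist_norm flip: scaleR_diff_right)
    also have "\<dots> \<le> 1 * dist x y"
      by (rule mult_right_mono) (use that N in \<open>auto simp: field_simps\<close>)
    finally show ?thesis
      by simp
  qed
  have "f y - f x = A x y" if xy: "x \<in> cball 0 r" "y \<in> cball 0 r" "dist x y < \<epsilon> / 2" for x y
  proof -
    have same: "A z z = 0" if "z \<in> cball 0 r" for z
      using cocycle[of z z z] that \<open>0 < \<epsilon>\<close> by simp
    have "(\<Sum>i<k. A (p y i) (p y (Suc i))) - (\<Sum>i<k. A (p x i) (p x (Suc i))) = A (p x k) (p y k)"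
      if "k \<le> N" for k
      using that
    proof (induction k)
      case 0
      have "0 \<in> cball (0::'a) r"
        using p_in[OF xy(1), of 0] by (simp add: p_def)
      then show ?case
        by (simp add: p_def same)
    next
      case (Suc k)
      have in': "p x k \<in> cball 0 r" "p y k \<in> cball 0 r" "p x (Suc k) \<in> cball 0 r"
        "p y (Suc k) \<in> cball 0 r"
        using Suc.prems xy p_in by auto
      have d: "dist (p x k) (p y k) < \<epsilon> / 2" "dist (p x (Suc k)) (p y (Suc k)) < \<epsilon> / 2"
        using p_dist[of k x y] p_dist[of "Suc k" x y] Suc.prems xy(3) by linarith+
      note d = d p_step[OF xy(1), of k] p_step[OF xy(2), of k]
      have diag: "dist (p x k) (p y (Suc k)) < \<epsilon>"
        using dist_triangle_half_l d dist_commute dist_triangle_half_r by metis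
      have "A (p x k) (p y k) + A (p y k) (p y (Suc k)) = A (p x k) (p y (Suc k))"
        by (rule cocycle) (use in' d diag \<open>0 < \<epsilon>\<close> in auto)
      moreover have "A (p x k) (p x (Suc k)) + A (p x (Suc k)) (p y (Suc k)) = A (p x k) (p y (Suc k))"
        by (rule cocycle) (use in' d diag \<open>0 < \<epsilon>\<close> in auto)
      ultimately show ?case
        using Suc by simp
    qed
    from this[of N] show ?thesis
      using N by (simp add: f_def p_def)
  qed
  then show ?thesis
    using \<open>0 < \<epsilon>\<close> by (intro exI[of _ f] exI[of _ "\<epsilon> / 2"]) auto
qed

text \<open>For a vertex \<open>v\<close> of \<open>K\<close> this is the usual open star, the
  points whose smallest simplex has \<open>v\<close> as a vertex, phrased without relative
  interiors.\<close>

definition open_star :: "'v::euclidean_space set set \<Rightarrow> 'v \<Rightarrow> 'v set" where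
  "open_star K v = {x \<in> \<Union>K. \<forall>S\<in>K. x \<in> S \<longrightarrow> v \<in> S}"

text \<open>Local finiteness enters here: near \<open>x\<close> only finitely many simplices avoid
  \<open>v\<close>, and removing their closed union leaves a neighbourhood of \<open>x\<close>
  inside the star.\<close>

lemma openin_open_star:
  assumes "geometric_complex K"
  shows "openin (top_of_set (\<Union>K)) (open_star K v)"
proof (subst openin_subopen, intro ballI)
  fix x
  assume x: "x \<in> open_star K v"
  then obtain S where "S \<in> K" "x \<in> S"
    by (auto simp: open_star_def)
  then obtain U where U: "open U" "x \<in> U" "finite {S \<in> K. S \<inter> U \<noteq> {}}"
    using geometric_complex_locally_finite[OF assms] by blast
  let ?F = "{S \<in> K. S \<inter> U \<noteq> {} \<and> v \<notin> S}"
  have "finite ?F"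
    by (rule finite_subset[OF _ U(3)]) auto
  moreover have "closed S" if "S \<in> K" for S
    using geometric_complex_simplex[OF assms that] closed_simplex by blast
  ultimately have "closed (\<Union>?F)"
    by (intro closed_Union) auto
  then have "openin (top_of_set (\<Union>K)) (\<Union>K \<inter> (U - \<Union>?F))"
    using U(1) by (intro openin_open_Int open_Diff)
  moreover have "x \<in> \<Union>K \<inter> (U - \<Union>?F)"
    using x U(2) by (auto simp: open_star_def)
  moreover have "\<Union>K \<inter> (U - \<Union>?F) \<subseteq> open_star K v"
    by (auto simp: open_star_def)
  ultimately show "\<exists>T. openin (top_of_set (\<Union>K)) T \<and> x \<in> T \<and> T \<subseteq> open_star K v"
    by blast
qed

text \<open>A simplex of least dimension among those containing \<open>x\<close> lies in all the
  others, since a proper intersection would be a face of smaller dimension. Any of its vertices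
  therefore has \<open>x\<close> in its open star.\<close>

lemma open_star_cover:
  assumes K: "geometric_complex K" and "x \<in> \<Union>K"
  obtains v where "{v} \<in> K" "x \<in> open_star K v"
proof -
  \<comment> \<open>The shift by one accounts for the dimension -1 of the empty set and keeps
    \<open>nat\<close> strictly increasing on all dimensions.\<close>
  define m where "m S = nat (aff_dim S + 1)" for S :: "'a set"
  obtain T where T: "T \<in> K" "x \<in> T" and min: "\<And>S. S \<in> K \<Longrightarrow> x \<in> S \<Longrightarrow> m T \<le> m S"
  proof -
    obtain S where "S \<in> K \<and> x \<in> S"
      using assms(2) by blast
    from ex_has_least_nat[of "\<lambda>S. S \<in> K \<and> x \<in> S", OF this, of m] show ?thesis
      using that by blast
  qed
  have sub: "T \<subseteq> S" if "S \<in> K" "x \<in> S" for S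
  proof (rule ccontr)
    assume "\<not> T \<subseteq> S"
    have f: "(T \<inter> S) face_of T"
      by (rule geometric_complex_Int[OF K T(1) that(1)])
    moreover have "convex T"
      using geometric_complex_simplex[OF K T(1)] convex_simplex by blast
    ultimately have "aff_dim (T \<inter> S) < aff_dim T"
      using \<open>\<not> T \<subseteq> S\<close> by (intro face_of_aff_dim_lt) auto
    moreover have "-1 \<le> aff_dim (T \<inter> S)"
      by (rule aff_dim_geq)
    ultimately have "m (T \<inter> S) < m T"
      by (simp add: m_def)
    moreover have "T \<inter> S \<in> K"
      by (rule geometric_complex_face[OF K T(1) f])
    ultimately show False
      using min[of "T \<inter> S"] T(2) that(2) by auto
  qed
  have "compact T" "convex T"
    using geometric_complex_simplex[OF K T(1)] convex_simplex compact_simplex by blast+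
  then obtain v where v: "v extreme_point_of T"
    using extreme_point_exists_convex[of T] T(2) by blast
  show ?thesis
  proof
    show "{v} \<in> K"
      by (rule extreme_point_vertex[OF K T(1) v])
    show "x \<in> open_star K v"
      using sub v assms(2) by (auto simp: open_star_def extreme_point_of_def)
  qed
qed

text \<open>The potential of a cocycle \<open>\<phi>\<close> on \<open>\<real>\<^sup>n\<close>: each point gets a vertex whose open star contains a
  ball of radius a Lebesgue number, and \<open>\<phi>\<close> of the edge between the vertices of two close points
  is a local cocycle.\<close>

lemma cocycle_potential_on_edges:
  fixes K :: "'v::euclidean_space set set" and h :: "'v \<Rightarrow> 'x::euclidean_space"
  assumes K: "geometric_complex K" "orientation_of K ord" and "linear \<phi>"
    and closed: "\<And>c. c \<in> simplicial_chains 2 K \<Longrightarrow> simplicial_coboundary ord \<phi> c = 0"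
    and hom: "homeomorphism (\<Union>K) UNIV h k"
    and E: "finite E" "E \<subseteq> K"
  obtains g where "\<And>a b. convex hull {a, b} \<in> E \<Longrightarrow> \<phi> (oriented_edge ord a b) = g b - g a"
proof -
  have kh: "k (h x) = x" if "x \<in> \<Union>K" for x
    by (rule homeomorphism_apply1[OF hom that])
  have k_in: "k y \<in> \<Union>K" for y
    using hom by (auto simp: homeomorphism_def)
  have cont_h: "continuous_on (\<Union>K) h" and cont_k: "continuous_on UNIV k"
    using hom by (auto simp: homeomorphism_def)
  \<comment> \<open>Finiteness of \<open>E\<close> confines the whole argument to one ball.\<close>
  have "compact (\<Union>E)"
  proof (rule compact_Union)
    fix S
    assume "S \<in> E"
    then show "compact S"
      using geometric_complex_simplex[OF K(1)] E(2) compact_simplex by blast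
  qed (use E in auto)
  then have "compact (h ` \<Union>E)"
    using E(2) cont_h by (meson Union_mono compact_continuous_image continuous_on_subset)
  then obtain r where r: "h ` \<Union>E \<subseteq> cball 0 r"
    using compact_imp_bounded bounded_subset_ballD ball_subset_cball by (meson order_trans)
  define G where "G v = k -` open_star K v" for v
  have open_G: "open (G v)" for v
  proof -
    have "openin (top_of_set UNIV) (UNIV \<inter> k -` open_star K v)"
      by (rule continuous_openin_preimage[OF cont_k funcsetI[OF k_in] openin_open_star[OF K(1)]])
    then show ?thesis
      by (simp add: G_def)
  qed
  have cover: "cball 0 r \<subseteq> \<Union>(G ` {v. {v} \<in> K})"
  proof
    fix y
    obtain v where "{v} \<in> K" "k y \<in> open_star K v"
      using open_star_cover[OF K(1) k_in] .
    then show "y \<in> \<Union>(G ` {v. {v} \<in> K})"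
      by (auto simp: G_def)
  qed
  obtain \<epsilon> where "0 < \<epsilon>"
    and eps: "\<And>y. y \<in> cball 0 r \<Longrightarrow> \<exists>U\<in>G ` {v. {v} \<in> K}. ball y \<epsilon> \<subseteq> U"
    by (rule Heine_Borel_lemma[OF compact_cball cover]) (use open_G in blast)+
  have "\<exists>v. {v} \<in> K \<and> ball y \<epsilon> \<subseteq> G v" if "y \<in> cball 0 r" for y
    using eps[OF that] by blast
  then obtain w where w: "\<And>y. y \<in> cball 0 r \<Longrightarrow> {w y} \<in> K \<and> ball y \<epsilon> \<subseteq> G (w y)"
    by metis
  \<comment> \<open>The ball around \<open>z\<close> lies in the preimage of the star of
    \<open>w z\<close>, so every simplex containing \<open>k y\<close> has \<open>w z\<close> as a
    vertex. Points near \<open>y\<close> thus receive vertices of a common simplex.\<close>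
  have w_in: "w z extreme_point_of S" if "z \<in> cball 0 r" "dist z y < \<epsilon>" "S \<in> K" "k y \<in> S" for y z S
  proof -
    have "y \<in> ball z \<epsilon>"
      using that(2) by simp
    then have "y \<in> G (w z)"
      using w[OF that(1)] by blast
    then have "w z \<in> S"
      using that(3,4) by (simp add: G_def open_star_def)
    then show ?thesis
      using vertex_extreme_point[OF K(1) _ that(3)] w[OF that(1)] by simp
  qed
  define A where "A y z = \<phi> (oriented_edge ord (w y) (w z))" for y z
  have "A x y + A y z = A x z"
    if xyz: "x \<in> cball 0 r" "y \<in> cball 0 r" "z \<in> cball 0 r" "dist x y < \<epsilon>" "dist y z < \<epsilon>"
      "dist x z < \<epsilon>" for x y z
  proof -
    \<comment> \<open>The middle point \<open>y\<close> is close to both others, so any simplex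
      around \<open>k y\<close> has all three assigned vertices.\<close>
    obtain S where S: "S \<in> K" "k y \<in> S"
      using k_in by blast
    have "w x extreme_point_of S" "w y extreme_point_of S" "w z extreme_point_of S"
      using w_in[OF xyz(1,4) S] w_in[OF xyz(2) _ S] w_in[OF xyz(3) _ S] xyz(5) \<open>0 < \<epsilon>\<close>
      by (simp_all add: dist_commute)
    then have "{w x, w y, w z} \<subseteq> {v. v extreme_point_of S}"
      by simp
    then show ?thesis
      unfolding A_def by (intro cocycle_triangle[OF K \<open>linear \<phi>\<close> closed S(1)])
  qed
  then have "\<exists>f. \<exists>\<delta>>0. \<forall>x\<in>cball 0 r. \<forall>y\<in>cball 0 r. dist x y < \<delta> \<longrightarrow> f y - f x = A x y"
    by (rule local_cocycle_potential[OF \<open>0 < \<epsilon>\<close>])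
  then obtain f \<delta> where "0 < \<delta>"
    and f: "\<And>x y. \<lbrakk>x \<in> cball 0 r; y \<in> cball 0 r; dist x y < \<delta>\<rbrakk> \<Longrightarrow> f y - f x = A x y"
    by meson
  have "\<phi> (oriented_edge ord a b) = f (h b) - f (h a)" if edge: "convex hull {a, b} \<in> E" for a b
  proof (cases "a = b")
    case True
    then show ?thesis
      by (simp add: linear_0[OF \<open>linear \<phi>\<close>])
  next
    case False
    let ?S = "convex hull {a, b}"
    have SK: "?S \<in> K" "?S \<subseteq> \<Union>K"
      using edge E(2) by auto
    have hr: "h x \<in> cball 0 r" if "x \<in> ?S" for x
      using r edge that by blast
    have ab: "a \<in> ?S" "b \<in> ?S"
      by (auto simp: hull_inc)
    have ext: "w (h x) extreme_point_of S" if "x \<in> ?S" "x \<in> S" "S \<in> K" for x S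
      using w_in[OF hr[OF that(1)], of "h x" S] that \<open>0 < \<epsilon>\<close> kh[OF UnionI[OF that(3,2)]] by simp
    have wab: "w (h x) = a \<or> w (h x) = b" if "x \<in> ?S" for x
      using ext[OF that that SK(1)] by (simp add: extreme_point_of_convex_hull_2)
    have "{a} \<in> K" "{b} \<in> K"
      using extreme_point_vertex[OF K(1) SK(1)] by (auto simp: extreme_point_of_convex_hull_2)
    \<comment> \<open>\<open>{a}\<close> is itself a simplex containing \<open>a\<close>, and its
      only vertex is \<open>a\<close>; likewise for \<open>b\<close>.\<close>
    then have w_end: "w (h a) = a" "w (h b) = b"
      using ext[OF ab(1), of "{a}"] ext[OF ab(2), of "{b}"] by (auto simp: extreme_point_of_def)
    \<comment> \<open>On the edge \<open>w\<close> takes only the values \<open>a\<close> and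
      \<open>b\<close>, so there \<open>A\<close> is the coboundary of this function of the assigned
      vertex. Hence \<open>f y - g (w y)\<close> is unchanged by steps shorter than
      \<open>\<delta>\<close> along the image of the edge.\<close>
    define g where "g v = (if v = a then 0 else \<phi> (oriented_edge ord a b))" for v
    have g: "A (h x) (h y) = g (w (h y)) - g (w (h x))" if "x \<in> ?S" "y \<in> ?S" for x y
    proof -
      have "\<phi> (oriented_edge ord b a) = - \<phi> (oriented_edge ord a b)"
        using oriented_edge_commute[OF K(2) SK(1)] by (simp add: linear_neg[OF \<open>linear \<phi>\<close>])
      then show ?thesis
        using wab[OF that(1)] wab[OF that(2)] False
        by (auto simp: A_def g_def linear_0[OF \<open>linear \<phi>\<close>])
    qed
    \<comment> \<open>\<open>h\<close> may stretch the edge beyond \<open>\<delta>\<close>; uniform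
      continuity yields a subdivision whose image has steps shorter than
      \<open>\<delta>\<close>.\<close>
    define l where "l t = a + t *\<^sub>R (b - a)" for t :: real
    have l_in: "l t \<in> ?S" if "t \<in> {0..1}" for t
      using that unfolding convex_hull_2_alt l_def by auto
    have "continuous_on {0..1} (\<lambda>t. h (l t))"
      using l_in SK(2) by (intro continuous_on_compose2[OF cont_h]) (auto simp: l_def intro!: continuous_intros)
    then have "uniformly_continuous_on {0..1} (\<lambda>t. h (l t))"
      by (intro compact_uniformly_continuous) auto
    then obtain \<eta> where "0 < \<eta>"
      and eta: "\<And>s t. \<lbrakk>s \<in> {0..1}; t \<in> {0..1}; dist t s < \<eta>\<rbrakk> \<Longrightarrow> dist (h (l t)) (h (l s)) < \<delta>"
      using \<open>0 < \<delta>\<close> unfolding uniformly_continuous_on_def by metis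
    obtain n where n: "inverse (real (Suc n)) < \<eta>"
      using reals_Archimedean[OF \<open>0 < \<eta>\<close>] by blast
    define u where "u i = h (l (real i / Suc n))" for i
    have const: "f (u i) - g (w (u i)) = f (u 0) - g (w (u 0))" if "i \<le> Suc n" for i
      using that
    proof (induction i)
      case (Suc i)
      let ?s = "real i / Suc n" and ?t = "real (Suc i) / Suc n"
      have st: "?s \<in> {0..1}" "?t \<in> {0..1}"
        using Suc.prems by auto
      have step: "?t - ?s = inverse (real (Suc n))"
        by (simp add: field_simps)
      have "dist ?s ?t = inverse (real (Suc n))"
        unfolding dist_real_def abs_minus_commute[of ?s] step by simp
      then have "dist ?s ?t < \<eta>"
        using n by (simp only:)
      then have "dist (u i) (u (Suc i)) < \<delta>"
        unfolding u_def by (intro eta st)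
      then have "f (u (Suc i)) - f (u i) = A (u i) (u (Suc i))"
        unfolding u_def by (intro f hr l_in st)
      then show ?case
        using g[OF l_in[OF st(1)] l_in[OF st(2)]] Suc by (simp add: u_def)
    qed simp
    have "u 0 = h a" "u (Suc n) = h b"
      by (simp_all add: u_def l_def)
    then show ?thesis
      using const[of "Suc n"] w_end False by (simp add: g_def)
  qed
  then show ?thesis
    using that[of "\<lambda>a. f (h a)"] by blast
qed

text \<open>On each edge of \<open>c\<close> the cocycle is a difference of vertex values, so
  \<open>\<phi> c\<close> is a linear function of the boundary of \<open>c\<close>.\<close>

lemma cocycle_vanishes_on_cycles:
  fixes K :: "'v::euclidean_space set set"
  assumes K: "geometric_complex K" "orientation_of K ord" and "linear \<phi>"
    and closed: "\<And>c. c \<in> simplicial_chains 2 K \<Longrightarrow> simplicial_coboundary ord \<phi> c = 0"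
    and hom: "\<Union>K homeomorphic (UNIV :: 'x::euclidean_space set)"
    and c: "c \<in> simplicial_chains 1 K" "simplicial_boundary ord c = 0"
  shows "\<phi> c = 0"
proof -
  obtain h :: "'v \<Rightarrow> 'x" and k where hk: "homeomorphism (\<Union>K) UNIV h k"
    using hom unfolding homeomorphic_def by blast
  have cK: "S \<in> K" "1 simplex S" if "S \<in> Poly_Mapping.keys c" for S
    using c(1) that by (auto simp: simplicial_chains_def)
  then obtain g where
    g: "\<And>a b. convex hull {a, b} \<in> Poly_Mapping.keys c \<Longrightarrow> \<phi> (oriented_edge ord a b) = g b - g a"
    using cocycle_potential_on_edges[OF K \<open>linear \<phi>\<close> closed hk finite_keys subsetI[OF cK(1)]]
    by metis
  \<comment> \<open>Vertices occur in chains as singletons; \<open>the_elem\<close> recovers the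
    point, so \<open>G\<close> extends \<open>g\<close> to 0-chains.\<close>
  define G where "G = linear_extension (\<lambda>S. g (the_elem S))"
  have "linear G"
    by (simp add: G_def linear_linear_extension)
  have "\<phi> (Poly_Mapping.single S 1) = G (simplex_boundary ord S)" if S: "S \<in> Poly_Mapping.keys c" for S
  proof -
    obtain a b where ab: "ord S = [a, b]" "a \<noteq> b" "S = convex hull {a, b}" "{a} \<in> K" "{b} \<in> K"
      using one_simplex_vertices[OF K cK[OF S]] by blast
    have "oriented_edge ord a b = Poly_Mapping.single S 1"
      using ab relative_sign_refl[of "[a, b]"] by (simp add: oriented_edge_def)
    then have "\<phi> (Poly_Mapping.single S 1) = g b - g a"
      using g[of a b] S ab(3) by simp
    also have "\<dots> = G (simplex_boundary ord S)"
      unfolding simplex_boundary_edge[of K ord S, OF K(2) ab(1,4,5)] linear_diff[OF \<open>linear G\<close>]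
      by (simp add: G_def)
    finally show ?thesis .
  qed
  then have "\<phi> c = linear_extension (\<lambda>S. G (simplex_boundary ord S)) c"
    by (subst linear_chain_expansion[OF \<open>linear \<phi>\<close>]) (rule linear_extension_cong)
  also have "\<dots> = G (simplicial_boundary ord c)"
    unfolding simplicial_boundary_def by (rule linear_linear_extension_eq[OF \<open>linear G\<close>, symmetric])
  finally show ?thesis
    using c(2) linear_0[OF \<open>linear G\<close>] by simp
qed

lemma discrete_loops_iff:
  fixes K :: "'v::euclidean_space set set"
  assumes K: "geometric_complex K" "orientation_of K ord" and "linear \<phi>"
    and hom: "\<Union>K homeomorphic (UNIV :: 'x::euclidean_space set)"
  shows "(\<forall>c\<in>simplicial_chains 1 K. simplicial_boundary ord c = 0 \<longrightarrow> \<phi> c = 0) \<longleftrightarrow>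
         (\<forall>c\<in>simplicial_chains 2 K. simplicial_coboundary ord \<phi> c = 0)"
proof
  assume "\<forall>c\<in>simplicial_chains 1 K. simplicial_boundary ord c = 0 \<longrightarrow> \<phi> c = 0"
  then show "\<forall>c\<in>simplicial_chains 2 K. simplicial_coboundary ord \<phi> c = 0"
    using simplicial_boundary_boundary[OF K] by (simp add: simplicial_coboundary_def)
next
  assume "\<forall>c\<in>simplicial_chains 2 K. simplicial_coboundary ord \<phi> c = 0"
  then show "\<forall>c\<in>simplicial_chains 1 K. simplicial_boundary ord c = 0 \<longrightarrow> \<phi> c = 0"
    using cocycle_vanishes_on_cycles[OF K \<open>linear \<phi>\<close> _ hom] by blast
qed

section \<open>Smooth 1-forms on a Euclidean space\<close>

lemma smooth_on_UNIV_differentiable: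
  "smooth_on UNIV f \<Longrightarrow> (f has_derivative frechet_derivative f (at x)) (at x)"
  unfolding smooth_on_def
  by (drule spec[of _ "Suc 0"]) (simp flip: frechet_derivative_works)

lemma smooth_on_continuous: "smooth_on U f \<Longrightarrow> continuous_on U f"
  unfolding smooth_on_def by (drule spec[of _ 0]) simp

lemma smooth_on_continuous_derivative:
  "smooth_on U f \<Longrightarrow> continuous_on U (\<lambda>x. frechet_derivative f (at x) v)"
  unfolding smooth_on_def by (drule spec[of _ "Suc 0"]) simp

lemma times_differentiable_on_const: "times_differentiable_on k U (\<lambda>_. c)"
  by (induction k arbitrary: c) simp_all

lemma smooth_on_affine:
  fixes a b :: "'x::real_normed_vector"
  shows "smooth_on UNIV (\<lambda>t::real. a + t *\<^sub>R b)"
  unfolding smooth_on_def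
proof
  fix k
  show "times_differentiable_on k UNIV (\<lambda>t::real. a + t *\<^sub>R b)"
  proof (cases k)
    case 0
    then show ?thesis
      by (auto intro!: continuous_intros)
  next
    case (Suc n)
    \<comment> \<open>The derivative in a fixed direction is constant, which settles all higher
      orders at once.\<close>
    have d: "((\<lambda>t. a + t *\<^sub>R b) has_derivative (\<lambda>t. t *\<^sub>R b)) (at t)" for t :: real
      by (auto intro!: derivative_eq_intros)
    then have "frechet_derivative (\<lambda>t. a + t *\<^sub>R b) (at t) = (\<lambda>t. t *\<^sub>R b)" for t :: real
      by (metis frechet_derivative_at)
    then show ?thesis
      using Suc d by (auto simp: times_differentiable_on_const differentiable_def)
  qed
qed

text \<open>The derivative within the interval sees only values on the interval, so it can be
  computed from \<open>g\<close> even though the stored curve is a restriction, one-sidedly at the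
  ends.\<close>

lemma curve_integral_restrict:
  assumes "\<And>t. t \<in> {0..1} \<Longrightarrow> (g has_vector_derivative g' t) (at t within {0..1})"
  shows "curve_integral \<omega> (restrict g {0..1}) = integral {0..1} (\<lambda>t. \<omega> (g t) (g' t))"
  unfolding curve_integral_def
proof (rule integral_cong)
  fix t :: real
  assume t: "t \<in> {0..1}"
  have "(restrict g {0..1} has_vector_derivative g' t) (at t within {0..1})"
    by (rule has_vector_derivative_transform[OF t _ assms[OF t]]) simp
  then have "vector_derivative (restrict g {0..1}) (at t within {0..1}) = g' t"
    using t by (intro vector_derivative_within_closed_interval) auto
  then show "\<omega> (restrict g {0..1} t) (vector_derivative (restrict g {0..1}) (at t within {0..1})) =
      \<omega> (g t) (g' t)"
    using t by simp
qed

section \<open>Calculus of a smooth 1-form\<close>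

locale smooth_1_form =
  fixes \<omega> :: "'x::euclidean_space \<Rightarrow> 'x \<Rightarrow> real"
  assumes smooth: "smooth_1_form_on UNIV \<omega>"
begin

text \<open>In \<open>coefficient_derivative x v w\<close> the form is evaluated on \<open>v\<close>
  and differentiated in direction \<open>w\<close>; closedness is symmetry in \<open>v\<close> and
  \<open>w\<close>.\<close>

definition coefficient_derivative :: "'x \<Rightarrow> 'x \<Rightarrow> 'x \<Rightarrow> real" where
  "coefficient_derivative x v = frechet_derivative (\<lambda>y. \<omega> y v) (at x)"

lemma exterior_derivative_eq:
  "exterior_derivative \<omega> x u v = coefficient_derivative x v u - coefficient_derivative x u v"
  by (simp add: exterior_derivative_def coefficient_derivative_def)

lemma linear_form: "linear (\<omega> x)"
  using smooth by (simp add: smooth_1_form_on_def)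

lemma has_coefficient_derivative:
  "((\<lambda>y. \<omega> y v) has_derivative coefficient_derivative x v) (at x)"
  unfolding coefficient_derivative_def
  using smooth by (intro smooth_on_UNIV_differentiable) (simp add: smooth_1_form_on_def)

lemma linear_coefficient_derivative: "linear (coefficient_derivative x v)"
  using has_coefficient_derivative has_derivative_linear by blast

lemma linear_coefficient_derivative_left: "linear (\<lambda>v. coefficient_derivative x v w)"
proof (rule linearI)
  fix a b
  have "((\<lambda>y. \<omega> y (a + b)) has_derivative
      (\<lambda>w. coefficient_derivative x a w + coefficient_derivative x b w)) (at x)"
    unfolding linear_add[OF linear_form]
    by (intro has_derivative_add has_coefficient_derivative)
  then show "coefficient_derivative x (a + b) w =
      coefficient_derivative x a w + coefficient_derivative x b w"
    using has_derivative_unique[OF has_coefficient_derivative] by metis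
next
  fix r a
  have "((\<lambda>y. \<omega> y (r *\<^sub>R a)) has_derivative (\<lambda>w. r *\<^sub>R coefficient_derivative x a w)) (at x)"
    unfolding linear_scale[OF linear_form]
    by (intro has_derivative_scaleR_right has_coefficient_derivative)
  then show "coefficient_derivative x (r *\<^sub>R a) w = r *\<^sub>R coefficient_derivative x a w"
    using has_derivative_unique[OF has_coefficient_derivative] by metis
qed

text \<open>Smoothness is assumed only for a fixed vector argument. Expanding over the basis extends
  continuity and differentiation to vectors that vary together with the base point.\<close>

lemma linear_expansion:
  fixes f :: "'x \<Rightarrow> real"
  assumes "linear f"
  shows "f v = (\<Sum>b\<in>Basis. (v \<bullet> b) * f b)"
proof -
  have "f v = f (\<Sum>b\<in>Basis. (v \<bullet> b) *\<^sub>R b)"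
    by (simp add: euclidean_representation)
  then show ?thesis
    by (simp add: linear_sum[OF assms] linear_scale[OF assms])
qed

lemma continuous_on_form [continuous_intros]:
  assumes p: "continuous_on S p" and v: "continuous_on S v"
  shows "continuous_on S (\<lambda>z. \<omega> (p z) (v z))"
proof -
  have "continuous_on UNIV (\<lambda>x. \<omega> x b)" for b
    using smooth by (intro smooth_on_continuous) (simp add: smooth_1_form_on_def)
  from continuous_on_compose2[OF this p] have "continuous_on S (\<lambda>z. \<omega> (p z) b)" for b
    by simp
  then have "continuous_on S (\<lambda>z. \<Sum>b\<in>Basis. (v z \<bullet> b) * \<omega> (p z) b)"
    by (intro continuous_intros v)
  then show ?thesis
    by (subst linear_expansion[OF linear_form])
qed

lemma continuous_on_coefficient_derivative [continuous_intros]: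
  assumes p: "continuous_on S p" and v: "continuous_on S v" and w: "continuous_on S w"
  shows "continuous_on S (\<lambda>z. coefficient_derivative (p z) (v z) (w z))"
proof -
  have "continuous_on UNIV (\<lambda>x. coefficient_derivative x b c)" for b c
    unfolding coefficient_derivative_def
    using smooth by (intro smooth_on_continuous_derivative) (simp add: smooth_1_form_on_def)
  from continuous_on_compose2[OF this p]
  have "continuous_on S (\<lambda>z. coefficient_derivative (p z) b c)" for b c
    by simp
  then have "continuous_on S
      (\<lambda>z. \<Sum>b\<in>Basis. (v z \<bullet> b) * (\<Sum>c\<in>Basis. (w z \<bullet> c) * coefficient_derivative (p z) b c))"
    by (intro continuous_intros v w)
  then show ?thesis
    by (simp flip: linear_expansion[OF linear_coefficient_derivative]
        linear_expansion[OF linear_coefficient_derivative_left])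
qed

text \<open>A product rule with one term for the moving base point and one for the moving vector,
  obtained from the basis expansion.\<close>

lemma form_has_field_derivative:
  assumes q: "(q has_vector_derivative q') (at t within S)"
    and r: "(r has_vector_derivative r') (at t within S)"
  shows "((\<lambda>t. \<omega> (q t) (r t)) has_field_derivative
      coefficient_derivative (q t) (r t) q' + \<omega> (q t) r') (at t within S)"
proof -
  have c: "((\<lambda>t. \<omega> (q t) b) has_field_derivative coefficient_derivative (q t) b q') (at t within S)"
    for b
  proof -
    have "((\<lambda>t. \<omega> (q t) b) has_derivative (\<lambda>s. coefficient_derivative (q t) b (s *\<^sub>R q'))) (at t within S)"
      by (rule has_derivative_compose[OF q[unfolded has_vector_derivative_def] has_coefficient_derivative])
    then show ?thesis
      by (simp add: linear_scale[OF linear_coefficient_derivative] has_vector_derivative_def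
          has_real_derivative_iff_has_vector_derivative)
  qed
  have i: "((\<lambda>t. r t \<bullet> b) has_field_derivative r' \<bullet> b) (at t within S)" for b
    using bounded_linear.has_vector_derivative[OF bounded_linear_inner_left r]
    by (simp add: has_real_derivative_iff_has_vector_derivative)
  have "((\<lambda>t. \<Sum>b\<in>Basis. (r t \<bullet> b) * \<omega> (q t) b) has_field_derivative
      (\<Sum>b\<in>Basis. (r t \<bullet> b) * coefficient_derivative (q t) b q' + (r' \<bullet> b) * \<omega> (q t) b)) (at t within S)"
    by (rule DERIV_sum) (rule DERIV_mult'[OF i c])
  then show ?thesis
    by (simp add: sum.distrib flip: linear_expansion[OF linear_form]
        linear_expansion[OF linear_coefficient_derivative_left])
qed

text \<open>Contract the curve \<open>g\<close> linearly to the origin: the derivative in \<open>s\<close> of the integral along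
  \<open>s g\<close> is a boundary term because the form is closed.\<close>

lemma closed_form_curve_integral:
  assumes closed: "\<And>x u v. exterior_derivative \<omega> x u v = 0" and "\<sigma> \<in> smooth_curves UNIV"
  defines "\<Psi> p \<equiv> integral {0..1} (\<lambda>s. \<omega> (s *\<^sub>R p) p)"
  shows "curve_integral \<omega> \<sigma> = \<Psi> (\<sigma> 1) - \<Psi> (\<sigma> 0)"
proof -
  obtain g where g: "\<sigma> = restrict g {0..1}" "smooth_on UNIV g"
    using assms(2) by (auto simp: smooth_curves_def)
  define g' where "g' t = frechet_derivative g (at t) 1" for t
  have g_deriv: "(g has_vector_derivative g' t) (at t within S)" for t S
  proof -
    note d = smooth_on_UNIV_differentiable[OF g(2), of t]
    have "frechet_derivative g (at t) s = s *\<^sub>R g' t" for s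
      using linear_scale[OF has_derivative_linear[OF d], of s 1] by (simp add: g'_def)
    then have "frechet_derivative g (at t) = (\<lambda>s. s *\<^sub>R g' t)"
      by (rule ext)
    with d have "(g has_vector_derivative g' t) (at t)"
      by (simp add: has_vector_derivative_def)
    then show ?thesis
      by (rule has_vector_derivative_at_within)
  qed
  have cont_g: "continuous_on UNIV g" and cont_g': "continuous_on UNIV g'"
    unfolding g'_def using smooth_on_continuous[OF g(2)] smooth_on_continuous_derivative[OF g(2)] .
  note [continuous_intros] = continuous_on_compose2[OF cont_g] continuous_on_compose2[OF cont_g']
  define I where "I s = integral {0..1} (\<lambda>t. \<omega> (s *\<^sub>R g t) (s *\<^sub>R g' t))" for s
  define B where "B s = \<omega> (s *\<^sub>R g 1) (g 1) - \<omega> (s *\<^sub>R g 0) (g 0)" for s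
  \<comment> \<open>The \<open>s\<close>-derivative of the integrand of \<open>I\<close>: the base
    point moves with velocity \<open>g t\<close>, the vector with velocity
    \<open>g' t\<close>.\<close>
  define D where "D s t = coefficient_derivative (s *\<^sub>R g t) (s *\<^sub>R g' t) (g t) + \<omega> (s *\<^sub>R g t) (g' t)"
    for s t
  have D_integral: "integral {0..1} (D s) = B s" for s
  proof (rule integral_unique)
    have "(D s has_integral \<omega> (s *\<^sub>R g 1) (g 1) - \<omega> (s *\<^sub>R g 0) (g 0)) {0..1}"
    proof (rule fundamental_theorem_of_calculus)
      fix t :: real
      have "((\<lambda>t. \<omega> (s *\<^sub>R g t) (g t)) has_field_derivative
          coefficient_derivative (s *\<^sub>R g t) (g t) (s *\<^sub>R g' t) + \<omega> (s *\<^sub>R g t) (g' t)) (at t within {0..1})"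
        by (intro form_has_field_derivative g_deriv bounded_linear.has_vector_derivative[OF bounded_linear_scaleR_right])
      \<comment> \<open>Closedness exchanges the two vectors and thereby identifies a
        \<open>t\<close>-derivative with the \<open>s\<close>-derivative
        \<open>D s t\<close>.\<close>
      moreover have "coefficient_derivative (s *\<^sub>R g t) (g t) (s *\<^sub>R g' t) =
          coefficient_derivative (s *\<^sub>R g t) (s *\<^sub>R g' t) (g t)"
        using closed[of "s *\<^sub>R g t" "g t" "s *\<^sub>R g' t"] by (simp add: exterior_derivative_eq)
      ultimately show "((\<lambda>t. \<omega> (s *\<^sub>R g t) (g t)) has_vector_derivative D s t) (at t within {0..1})"
        by (simp add: D_def has_real_derivative_iff_has_vector_derivative)
    qed simp
    then show "(D s has_integral B s) {0..1}"
      by (simp add: B_def)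
  qed
  have "(I has_field_derivative B s) (at s within {0..1})" if "s \<in> {0..1}" for s
  proof -
    have "((\<lambda>s. integral (cbox 0 1) (\<lambda>t. \<omega> (s *\<^sub>R g t) (s *\<^sub>R g' t))) has_field_derivative
        integral (cbox 0 1) (D s)) (at s within {0..1})"
    proof (rule leibniz_rule_field_derivative)
      fix s t :: real
      show "((\<lambda>s. \<omega> (s *\<^sub>R g t) (s *\<^sub>R g' t)) has_field_derivative D s t) (at s within {0..1})"
        unfolding D_def
        by (intro form_has_field_derivative) (auto intro!: derivative_eq_intros)
      show "(\<lambda>t. \<omega> (s *\<^sub>R g t) (s *\<^sub>R g' t)) integrable_on cbox 0 1"
        by (intro integrable_continuous continuous_intros) auto
      show "continuous_on ({0..1} \<times> cbox 0 1) (\<lambda>(s, t). D s t)"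
        unfolding D_def split_beta by (intro continuous_intros) auto
    qed (use that in auto)
    then show ?thesis
      unfolding I_def using D_integral by simp
  qed
  \<comment> \<open>\<open>B\<close> is integrated in two ways: as the derivative of
    \<open>I\<close>, and term by term as the potential at the two ends.\<close>
  then have "(B has_integral I 1 - I 0) {0..1}"
    by (intro fundamental_theorem_of_calculus)
       (auto simp: has_real_derivative_iff_has_vector_derivative)
  moreover have "(B has_integral \<Psi> (g 1) - \<Psi> (g 0)) {0..1}"
    unfolding B_def \<Psi>_def
    by (intro has_integral_diff integrable_integral integrable_continuous_interval continuous_intros)
  moreover have "I 0 = 0"
    by (simp add: I_def linear_0[OF linear_form])
  moreover have "curve_integral \<omega> \<sigma> = I 1"
    unfolding g(1) I_def using curve_integral_restrict[of g g'] g_deriv by simp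
  moreover have "\<sigma> 0 = g 0" "\<sigma> 1 = g 1"
    by (simp_all add: g(1))
  ultimately show ?thesis
    using has_integral_unique[of B "I 1 - I 0" "{0..1}" "\<Psi> (g 1) - \<Psi> (g 0)"] by simp
qed

text \<open>The integral over each curve is a difference of \<open>\<Psi>\<close> at its ends, so
  the pairing factors through the boundary, as for simplicial cycles.\<close>

lemma closed_form_vanishes_on_cycles:
  assumes closed: "\<And>x u v. exterior_derivative \<omega> x u v = 0"
    and c: "c \<in> singular_1_chains UNIV" "singular_boundary c = 0"
  shows "linear_extension (curve_integral \<omega>) c = 0"
proof -
  define \<Psi> where "\<Psi> p = integral {0..1} (\<lambda>s. \<omega> (s *\<^sub>R p) p)" for p
  have "linear (linear_extension \<Psi>)"
    by (rule linear_linear_extension)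
  have "linear_extension (curve_integral \<omega>) c =
      linear_extension (\<lambda>\<sigma>. linear_extension \<Psi>
        (Poly_Mapping.single (\<sigma> 1) 1 - Poly_Mapping.single (\<sigma> 0) 1)) c"
  proof (rule linear_extension_cong)
    fix \<sigma>
    assume "\<sigma> \<in> Poly_Mapping.keys c"
    then have "\<sigma> \<in> smooth_curves UNIV"
      using c(1) by (auto simp: singular_1_chains_def)
    then show "curve_integral \<omega> \<sigma> = linear_extension \<Psi>
        (Poly_Mapping.single (\<sigma> 1) 1 - Poly_Mapping.single (\<sigma> 0) 1)"
      using closed_form_curve_integral[OF closed]
      by (simp add: linear_diff[OF \<open>linear (linear_extension \<Psi>)\<close>] \<Psi>_def)
  qed
  also have "\<dots> = linear_extension \<Psi> (singular_boundary c)"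
    unfolding singular_boundary_def
    by (rule linear_linear_extension_eq[OF \<open>linear (linear_extension \<Psi>)\<close>, symmetric])
  finally show ?thesis
    using c(2) linear_0[OF \<open>linear (linear_extension \<Psi>)\<close>] by simp
qed

section \<open>Segments and parallelogram loops\<close>

definition segment_curve :: "'x \<Rightarrow> 'x \<Rightarrow> real \<Rightarrow> 'x" where
  "segment_curve a v = restrict (\<lambda>t. a + t *\<^sub>R v) {0..1}"

lemma segment_curve_smooth: "segment_curve a v \<in> smooth_curves UNIV"
  unfolding smooth_curves_def segment_curve_def using smooth_on_affine[of a v] by blast

lemma segment_curve_ends: "segment_curve a v 0 = a" "segment_curve a v 1 = a + v"
  by (simp_all add: segment_curve_def)

lemma curve_integral_segment_curve:
  "curve_integral \<omega> (segment_curve a v) = integral {0..1} (\<lambda>t. \<omega> (a + t *\<^sub>R v) v)"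
  unfolding segment_curve_def
  by (rule curve_integral_restrict) (auto intro!: derivative_eq_intros)

text \<open>The four sides form a cycle, with opposite sides sharing a parametrisation up to
  translation and entering with opposite signs. A single integral allows the later estimate to be
  made pointwise in \<open>t\<close>.\<close>

lemma parallelogram_integral:
  assumes loops: "\<And>c. \<lbrakk>c \<in> singular_1_chains UNIV; singular_boundary c = 0\<rbrakk> \<Longrightarrow>
      linear_extension (curve_integral \<omega>) c = 0"
  shows "integral {0..1} (\<lambda>t. \<omega> (x + t *\<^sub>R u) u + \<omega> (x + u + t *\<^sub>R v) v
      - \<omega> (x + v + t *\<^sub>R u) u - \<omega> (x + t *\<^sub>R v) v) = 0"
proof -
  let ?s = "\<lambda>a v. Poly_Mapping.single (segment_curve a v) (1::real)"
  define c where "c = ?s x u + ?s (x + u) v - ?s (x + v) u - ?s x v"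
  have "Poly_Mapping.keys c \<subseteq> {segment_curve x u, segment_curve (x + u) v,
      segment_curve (x + v) u, segment_curve x v}"
    by (auto simp: c_def in_keys_iff lookup_add lookup_minus lookup_single when_def split: if_splits)
  then have "c \<in> singular_1_chains UNIV"
    using segment_curve_smooth by (auto simp: singular_1_chains_def)
  moreover have "singular_boundary c = 0"
    unfolding singular_boundary_def c_def linear_add[OF linear_linear_extension]
      linear_diff[OF linear_linear_extension]
    by (simp add: segment_curve_ends algebra_simps)
  ultimately have "linear_extension (curve_integral \<omega>) c = 0"
    by (rule loops)
  then have "integral {0..1} (\<lambda>t. \<omega> (x + t *\<^sub>R u) u) + integral {0..1} (\<lambda>t. \<omega> (x + u + t *\<^sub>R v) v)
      - integral {0..1} (\<lambda>t. \<omega> (x + v + t *\<^sub>R u) u) - integral {0..1} (\<lambda>t. \<omega> (x + t *\<^sub>R v) v) = 0"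
    unfolding c_def linear_add[OF linear_linear_extension] linear_diff[OF linear_linear_extension]
    by (simp add: curve_integral_segment_curve)
  moreover have "(\<lambda>t. \<omega> (a + t *\<^sub>R b) b) integrable_on {0..1::real}" for a b
    by (intro integrable_continuous_interval continuous_intros)
  ultimately show ?thesis
    by (simp add: integral_add integral_diff integrable_add integrable_diff)
qed

text \<open>On a parallelogram with sides \<open>h u\<close> and \<open>h v\<close> the loop integral is
  \<open>h\<^sup>2 * exterior_derivative \<omega> x u v\<close> up to \<open>o(h\<^sup>2)\<close>.\<close>

lemma exterior_derivative_zero:
  assumes loops: "\<And>c. \<lbrakk>c \<in> singular_1_chains UNIV; singular_boundary c = 0\<rbrakk> \<Longrightarrow>
      linear_extension (curve_integral \<omega>) c = 0"
  shows "exterior_derivative \<omega> x u v = 0"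
proof -
  define M where "M = norm u + norm v"
  \<comment> \<open>The factor 4 counts the sides of the parallelogram. The bound is free of the
    side length, so \<open>e\<close> can be made arbitrarily small afterwards.\<close>
  have bound: "\<bar>exterior_derivative \<omega> x u v\<bar> \<le> 4 * e * M" if "e > 0" for e
  proof -
    have approx: "\<exists>d>0. \<forall>y. norm (y - x) < d \<longrightarrow>
        \<bar>\<omega> y w - \<omega> x w - coefficient_derivative x w (y - x)\<bar> \<le> e * norm (y - x)" for w
      using has_coefficient_derivative[of w x] \<open>e > 0\<close> unfolding has_derivative_at_alt by auto
    obtain d1 where d1: "d1 > 0" "\<And>y. norm (y - x) < d1 \<Longrightarrow>
        \<bar>\<omega> y u - \<omega> x u - coefficient_derivative x u (y - x)\<bar> \<le> e * norm (y - x)"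
      using approx by blast
    obtain d2 where d2: "d2 > 0" "\<And>y. norm (y - x) < d2 \<Longrightarrow>
        \<bar>\<omega> y v - \<omega> x v - coefficient_derivative x v (y - x)\<bar> \<le> e * norm (y - x)"
      using approx by blast
    \<comment> \<open>The extra 1 makes \<open>h * M\<close> strictly smaller than both radii and
      permits \<open>M = 0\<close>.\<close>
    define h where "h = min d1 d2 / (M + 1)"
    have "M \<ge> 0"
      by (simp add: M_def)
    then have h: "h > 0" "h * M < d1" "h * M < d2"
    proof -
      show "h > 0"
        using d1(1) d2(1) \<open>M \<ge> 0\<close> by (simp add: h_def)
      have "h * (M + 1) = min d1 d2"
        using \<open>M \<ge> 0\<close> by (simp add: h_def)
      then show "h * M < d1" "h * M < d2"
        using \<open>h > 0\<close> by (auto simp: algebra_simps min_def split: if_splits)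
    qed
    have near: "norm (s *\<^sub>R u + t *\<^sub>R v) \<le> h * M" if "\<bar>s\<bar> \<le> h" "\<bar>t\<bar> \<le> h" for s t
    proof -
      have "norm (s *\<^sub>R u + t *\<^sub>R v) \<le> \<bar>s\<bar> * norm u + \<bar>t\<bar> * norm v"
        using norm_triangle_ineq[of "s *\<^sub>R u" "t *\<^sub>R v"] by simp
      also have "\<dots> \<le> h * norm u + h * norm v"
        using that by (intro add_mono mult_right_mono) auto
      finally show ?thesis
        by (simp add: M_def algebra_simps)
    qed
    have est: "\<bar>\<omega> (x + (s *\<^sub>R u + t *\<^sub>R v)) w - \<omega> x w
          - (s * coefficient_derivative x w u + t * coefficient_derivative x w v)\<bar> \<le> e * (h * M)"
      if st: "\<bar>s\<bar> \<le> h" "\<bar>t\<bar> \<le> h" and w: "w = u \<or> w = v" for s t w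
    proof -
      let ?y = "x + (s *\<^sub>R u + t *\<^sub>R v)"
      have "norm (?y - x) \<le> h * M"
        using near[OF st] by simp
      moreover from this have "\<bar>\<omega> ?y w - \<omega> x w - coefficient_derivative x w (?y - x)\<bar> \<le> e * norm (?y - x)"
        using w d1(2)[of ?y] d2(2)[of ?y] h by fastforce
      moreover have "coefficient_derivative x w (?y - x) =
          s * coefficient_derivative x w u + t * coefficient_derivative x w v"
        by (simp add: linear_add[OF linear_coefficient_derivative]
            linear_scale[OF linear_coefficient_derivative])
      ultimately show ?thesis
        using \<open>e > 0\<close> by (smt (verit) mult_left_mono)
    qed
    let ?\<Phi> = "\<lambda>t. \<omega> (x + t *\<^sub>R h *\<^sub>R u) (h *\<^sub>R u) + \<omega> (x + h *\<^sub>R u + t *\<^sub>R h *\<^sub>R v) (h *\<^sub>R v)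
      - \<omega> (x + h *\<^sub>R v + t *\<^sub>R h *\<^sub>R u) (h *\<^sub>R u) - \<omega> (x + t *\<^sub>R h *\<^sub>R v) (h *\<^sub>R v)"
    let ?C = "exterior_derivative \<omega> x u v"
    have "norm (?\<Phi> t - h * (h * ?C)) \<le> h * (4 * (e * (h * M)))" if t: "t \<in> {0..1}" for t
    proof -
      have th: "\<bar>t * h\<bar> \<le> h" "\<bar>h\<bar> \<le> h" "\<bar>0\<bar> \<le> h"
        using t h(1) by (auto simp: abs_mult mult_le_cancel_right1)
      let ?p = "\<lambda>s t w. \<omega> (x + (s *\<^sub>R u + t *\<^sub>R v)) w"
      have "?\<Phi> t = h * (?p (t * h) 0 u + ?p h (t * h) v - ?p (t * h) h u - ?p 0 (t * h) v)"
        by (simp add: linear_scale[OF linear_form] algebra_simps)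
      then have "?\<Phi> t - h * (h * ?C) =
          h * (?p (t * h) 0 u + ?p h (t * h) v - ?p (t * h) h u - ?p 0 (t * h) v - h * ?C)"
        by (simp add: algebra_simps)
      \<comment> \<open>To first order the values at \<open>x\<close> and the terms in
        \<open>t * h\<close> cancel between opposite sides, leaving \<open>h * ?C\<close>; what
        remains is the four errors from \<open>est\<close>.\<close>
      moreover have "\<bar>?p (t * h) 0 u + ?p h (t * h) v - ?p (t * h) h u - ?p 0 (t * h) v - h * ?C\<bar>
          \<le> 4 * (e * (h * M))"
        using est[OF th(1,3), of u] est[OF th(2,1), of v] est[OF th(1,2), of u] est[OF th(3,1), of v]
        unfolding exterior_derivative_eq by (simp add: algebra_simps abs_le_iff)
      ultimately show ?thesis
        using h(1) by (simp add: abs_mult)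
    qed
    then have "norm (integral {0..1} (\<lambda>t. ?\<Phi> t - h * (h * ?C))) \<le> h * (4 * (e * (h * M))) * (1 - 0)"
      by (intro integral_bound continuous_intros) auto
    moreover have "integral {0..1} (\<lambda>t. ?\<Phi> t - h * (h * ?C)) = 0 - h * (h * ?C)"
    proof (rule integral_unique)
      have "(?\<Phi> has_integral integral {0..1} ?\<Phi>) {0..1}"
        by (intro integrable_integral integrable_continuous_interval continuous_intros)
      then have "(?\<Phi> has_integral 0) {0..1}"
        by (simp only: parallelogram_integral[OF loops])
      from has_integral_diff[OF this has_integral_const_real[of "h * (h * ?C)" 0 1]]
      show "((\<lambda>t. ?\<Phi> t - h * (h * ?C)) has_integral 0 - h * (h * ?C)) {0..1}"
        by simp
    qed
    ultimately have "(h * h) * \<bar>?C\<bar> \<le> (h * h) * (4 * e * M)"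
      using h(1) by (simp add: abs_mult mult_ac)
    then show ?thesis
      using h(1) by simp
  qed
  have "\<bar>exterior_derivative \<omega> x u v\<bar> \<le> 0 + e" if "e > 0" for e
  proof -
    have "M \<ge> 0"
      by (simp add: M_def)
    have "4 * (e / (4 * (M + 1))) * M \<le> e"
      using that \<open>M \<ge> 0\<close> by (simp add: field_simps)
    then show ?thesis
      using bound[of "e / (4 * (M + 1))"] that \<open>M \<ge> 0\<close> by simp
  qed
  then show ?thesis
    using field_le_epsilon[of "\<bar>exterior_derivative \<omega> x u v\<bar>" 0] by simp
qed

end

section \<open>Noncontextuality and curvature\<close>

text \<open>\<open>is_one_form\<close> forces space and form to be of the same kind, so each case
  reduces to a statement about bare chains.\<close>

lemma phases_zero_iff_curvature_zero:
  assumes "is_space M" "flat M" "is_one_form M \<omega>"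
  shows "(\<forall>\<gamma>\<in>loops M. pairing \<omega> \<gamma> = 0) \<longleftrightarrow> is_zero_two_form M (curvature M \<omega>)"
proof (cases M)
  case (Discrete K ord)
  then obtain \<phi> where \<phi>: "\<omega> = Cochain_1 \<phi>" "linear \<phi>"
    using assms(3) by (cases \<omega>) auto
  have "geometric_complex K" "orientation_of K ord" "\<Union>K homeomorphic (UNIV :: 'a set)"
    using assms(1,2) Discrete by simp_all
  from discrete_loops_iff[OF this(1,2) \<phi>(2) this(3)] show ?thesis
    by (simp add: Discrete \<phi>(1)) (simp add: Ball_def imp_conjL)
next
  case (Continuous U)
  then obtain \<eta> where \<eta>: "\<omega> = Differential_1 \<eta>" "smooth_1_form_on U \<eta>"
    using assms(3) by (cases \<omega>) auto
  have U: "U = UNIV"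
    using assms(2) Continuous by simp
  interpret smooth_1_form \<eta>
    by unfold_locales (use \<eta>(2) U in simp)
  have "(\<forall>c\<in>singular_1_chains UNIV. singular_boundary c = 0 \<longrightarrow>
           linear_extension (curve_integral \<eta>) c = 0) \<longleftrightarrow>
        (\<forall>x u v. exterior_derivative \<eta> x u v = 0)"
    using closed_form_vanishes_on_cycles exterior_derivative_zero by blast
  then show ?thesis
    by (simp add: Continuous \<eta>(1) U) (simp add: Ball_def imp_conjL)
qed

theorem theorem5:
  fixes R :: "('e::euclidean_space, 'u::euclidean_space, 't::euclidean_space, 'v::euclidean_space,
               'p::euclidean_space, 'w::euclidean_space, 'l) ontic_structure"
  assumes "ontic_representation R"
    and "flat_representation R"
  shows "(noncontextual_for_measurements R \<longleftrightarrow>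
            (\<forall>l'\<in>ontic_set R.
               is_zero_two_form (effect_space R) (curvature (effect_space R) (xi R l')))) \<and>
         (noncontextual_for_transformations R \<longleftrightarrow>
            (\<forall>l\<in>ontic_set R. \<forall>l'\<in>ontic_set R.
               is_zero_two_form (transformation_space R)
                 (curvature (transformation_space R) (Gamma R l' l)))) \<and>
         (noncontextual_for_states R \<longleftrightarrow>
            (\<forall>l\<in>ontic_set R.
               is_zero_two_form (state_space R) (curvature (state_space R) (mu R l))))"
proof -
  note rep = assms(1)[unfolded ontic_representation_def encoding_def]
  note fl = assms(2)[unfolded flat_representation_def]
  have "(\<forall>\<gamma>\<in>loops (effect_space R). pairing (xi R l') \<gamma> = 0) \<longleftrightarrow>
      is_zero_two_form (effect_space R) (curvature (effect_space R) (xi R l'))"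
    if "l' \<in> ontic_set R" for l'
    by (rule phases_zero_iff_curvature_zero) (use rep fl that in simp_all)
  moreover have "(\<forall>\<gamma>\<in>loops (transformation_space R). pairing (Gamma R l' l) \<gamma> = 0) \<longleftrightarrow>
      is_zero_two_form (transformation_space R) (curvature (transformation_space R) (Gamma R l' l))"
    if "l \<in> ontic_set R" "l' \<in> ontic_set R" for l l'
    by (rule phases_zero_iff_curvature_zero) (use rep fl that in simp_all)
  moreover have "(\<forall>\<gamma>\<in>loops (state_space R). pairing (mu R l) \<gamma> = 0) \<longleftrightarrow>
      is_zero_two_form (state_space R) (curvature (state_space R) (mu R l))"
    if "l \<in> ontic_set R" for l
    by (rule phases_zero_iff_curvature_zero) (use rep fl that in simp_all)
  ultimately show ?thesis
    unfolding noncontextual_for_measurements_def noncontextual_for_transformations_def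
      noncontextual_for_states_def
    by blast
qed

end
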